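(* (i) If $\omega$ is a superharmonic weight and $f\in\mathcal D_\omega$, then $\|\sigma_n(f)-f\|_{\mathcal D_\omega}\to0$ as $n\to\infty$. (ii) There exist a superharmonic weight $\omega$ and a function $f\in\mathcal D_\omega$ such that $\|s_n(f)-f\|_{\mathcal D_\omega}\not\to0$ as $n\to\infty$.
   Context: $\mathbb D$ is the open unit disk, $dA$ is normalized area measure on $\mathbb D$. A superharmonic weight is a positive superharmonic function $\omega$ on $\mathbb D$. For $f$ holomorphic on $\mathbb D$, $\mathcal D_\omega(f):=\int_{\mathbb D}|f'(z)|^2\omega(z)\,dA(z)$, $\mathcal D_\omega$ is the space of holomorphic $f$ on $\mathbb D$ with $\mathcal D_\omega(f)<\infty$, with norm $\|f\|^2_{\mathcal D_\omega}=|f(0)|^2+\mathcal D_\omega(f)$. For $f(z)=\sum_{k\ge0}a_kz^k$, $s_n(f)(z):=\sum_{k=0}^na_kz^k$ and $\sigma_n(f):=\frac1{n+1}\sum_{k=0}^ns_k(f)$. *)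

theory Defs
  imports "HOL-Analysis.Analysis"
begin

abbreviation unit_disk :: "complex set" where
  "unit_disk \<equiv> ball 0 1"

text \<open>Superharmonic weight: a positive superharmonic function on the unit disk,
  with values in (0, +infinity]. Superharmonic: lower semicontinuous, not identically
  +infinity (the disk is connected), and satisfying the super-mean-value inequality
  on every closed disk contained in the unit disk.\<close>
definition superharmonic_weight :: "(complex \<Rightarrow> ennreal) \<Rightarrow> bool" where
  "superharmonic_weight \<omega> \<longleftrightarrow>
     (\<forall>z\<in>unit_disk. 0 < \<omega> z) \<and>
     (\<forall>z\<in>unit_disk. \<omega> z \<le> Liminf (at z) \<omega>) \<and>
     (\<exists>z\<in>unit_disk. \<omega> z < \<infinity>) \<and>
     (\<forall>a r. 0 < r \<longrightarrow> cball a r \<subseteq> unit_disk \<longrightarrow>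
        (\<integral>\<^sup>+ t\<in>{0..2*pi}. \<omega> (a + complex_of_real r * cis t) \<partial>lborel) / ennreal (2*pi) \<le> \<omega> a)"

text \<open>Weighted Dirichlet integral, with dA = normalized area measure (Lebesgue / pi).\<close>
definition dirichlet_integral :: "(complex \<Rightarrow> ennreal) \<Rightarrow> (complex \<Rightarrow> complex) \<Rightarrow> ennreal" where
  "dirichlet_integral \<omega> f =
     (\<integral>\<^sup>+ z\<in>unit_disk. ennreal ((cmod (deriv f z))\<^sup>2) * \<omega> z \<partial>lborel) / ennreal pi"

definition in_D :: "(complex \<Rightarrow> ennreal) \<Rightarrow> (complex \<Rightarrow> complex) \<Rightarrow> bool" where
  "in_D \<omega> f \<longleftrightarrow> f holomorphic_on unit_disk \<and> dirichlet_integral \<omega> f < \<infinity>"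

definition D_norm_sq :: "(complex \<Rightarrow> ennreal) \<Rightarrow> (complex \<Rightarrow> complex) \<Rightarrow> ennreal" where
  "D_norm_sq \<omega> f = ennreal ((cmod (f 0))\<^sup>2) + dirichlet_integral \<omega> f"

definition taylor_coeff :: "(complex \<Rightarrow> complex) \<Rightarrow> nat \<Rightarrow> complex" where
  "taylor_coeff f k = (deriv ^^ k) f 0 / of_nat (fact k)"

definition partial_sum :: "nat \<Rightarrow> (complex \<Rightarrow> complex) \<Rightarrow> complex \<Rightarrow> complex" where
  "partial_sum n f z = (\<Sum>k\<le>n. taylor_coeff f k * z ^ k)"

definition cesaro_mean :: "nat \<Rightarrow> (complex \<Rightarrow> complex) \<Rightarrow> complex \<Rightarrow> complex" where
  "cesaro_mean n f z = (\<Sum>k\<le>n. partial_sum k f z) / of_nat (n + 1)"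

end

theory Submission
  imports Defs "HOL-Complex_Analysis.Complex_Analysis"
begin

text \<open>
  Write \<open>D f\<close> for the integral of \<open>|f'|\<^sup>2 \<omega>\<close> over the disk. Testing superharmonicity against
  \<open>(1 - |z|\<^sup>2)\<^sup>2 |f|\<^sup>2\<close> shows that multiplication by \<open>z\<close> is a concave operator:
  \<open>D (z\<^sup>2 f) + D f \<le> 2 D (z f)\<close>. Since \<open>D \<ge> 0\<close>, iterating forces the defect \<open>q f = D (z f) - D f\<close> to be
  nonnegative, and concavity says \<open>q (z f) \<le> q f\<close>. As \<open>D\<close> ignores constants, \<open>D g = D h + q h\<close>
  whenever \<open>g = c + z h\<close>; running this recursion along the Taylor tails of \<open>f\<close> and of \<open>\<sigma>\<^sub>n f\<close> simultaneously
  gives \<open>D (\<sigma>\<^sub>n f) \<le> D f\<close>. Pointwise convergence of the derivatives, Fatou's lemma and the parallelogram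
  law turn this contractivity into \<open>D (\<sigma>\<^sub>n f - f) \<rightarrow> 0\<close>.

  For the partial sums take the Poisson kernel at \<open>1\<close> as weight, normalising \<open>D\<close> by \<open>1/\<pi>\<close>. Then
  \<open>D (z\<^sup>m) = m\<close> while \<open>D (z\<^sup>m\<^sup>+\<^sup>1 - z\<^sup>m)\<close> is bounded, so \<open>f = \<Sum>\<^sub>j 2\<^sup>-\<^sup>j (z\<^sup>m\<^sup>+\<^sup>1 - z\<^sup>m)\<close> with
  \<open>m = 4\<^sup>j\<close> lies in the space, but its Taylor terms \<open>2\<^sup>-\<^sup>j z\<^sup>m\<close> do not tend to \<open>0\<close> in norm.
\<close>

subsection \<open>Rotation averages of Lebesgue measure\<close>

text \<open>The weight may be infinite at points and has no derivatives, so no Laplacian of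
  \<open>\<omega>\<close> is formed: Fubini moves circle means from a test function to
  \<open>\<omega>\<close>, and local integrability of \<open>\<omega>\<close> licenses the limit of
  small radii. The concavity inequality is proved in \<open>ennreal\<close> for energies that may be
  infinite; it thereby also supplies the finiteness of the energies of Taylor tails, without which
  the defect, a real difference, would be meaningless.

  Contractivity rests on |m x - y|^2 / N^2 + |x + y|^2 / (m + 1) \<le> |x|^2 + |y|^2 / m, valid when
  m (m + 1) \<le> N^2. Here x stands for a tail of f, y for the shifted tails accumulated so far,
  and N = n + 1. The defect is a nonnegative quadratic form, so it inherits the inequality. The
  induction only meets m \<le> n, and this is where the normalisation of the Cesaro mean enters.

  In the counterexample the difference of neighbouring powers vanishes at 1, the singularity of the
  kernel, and so stays cheap, while a single power costs its degree. Amplitude 2^-j against degree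
  4^j makes squared amplitude times degree exactly 1.\<close>

lemma nn_integral_lborel_translate:
  fixes g :: "'a::euclidean_space \<Rightarrow> ennreal"
  assumes [measurable]: "g \<in> borel_measurable borel"
  shows "(\<integral>\<^sup>+x. g (c + x) \<partial>lborel) = (\<integral>\<^sup>+x. g x \<partial>lborel)"
proof -
  have "(\<integral>\<^sup>+x. g x \<partial>lborel) = (\<integral>\<^sup>+x. g x \<partial>distr lborel borel ((+) c))"
    by (simp add: lborel_distr_plus)
  also have "\<dots> = (\<integral>\<^sup>+x. g (c + x) \<partial>lborel)"
    by (subst nn_integral_distr) auto
  finally show ?thesis by simp
qed

text \<open>Uniqueness of Haar measure, made explicit: integrating \<open>\<phi> y * g (u * x + y)\<close> in both orders,
  with \<open>\<phi>\<close> the indicator of the unit ball, compares the rotated measure with the original one.\<close>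

lemma nn_integral_lborel_rotate:
  fixes g :: "complex \<Rightarrow> ennreal"
  assumes [measurable]: "g \<in> borel_measurable borel" and u: "cmod u = 1"
  shows "(\<integral>\<^sup>+x. g (u * x) \<partial>lborel) = (\<integral>\<^sup>+x. g x \<partial>lborel)"
proof -
  define \<phi> where "\<phi> = (indicator (ball 0 1) :: complex \<Rightarrow> ennreal)"
  have [measurable]: "\<phi> \<in> borel_measurable borel" unfolding \<phi>_def by (intro borel_measurable_indicator) auto
  have u0: "u \<noteq> 0" using u by auto
  define V where "V = (\<integral>\<^sup>+y. \<phi> y \<partial>lborel)"
  have V: "V = emeasure lborel (ball (0::complex) 1)"
    unfolding V_def \<phi>_def by (simp add: nn_integral_indicator)
  have V0: "V \<noteq> 0" "V \<noteq> \<infinity>"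
    unfolding V by (auto simp: emeasure_ball eval_unit_ball_vol)
  define N where "N = (\<integral>\<^sup>+x. g (u * x) \<partial>lborel)"
  have rad: "\<phi> (y - u * x) = \<phi> (inverse u * y - x)" for x y
  proof -
    have "y - u * x = u * (inverse u * y - x)"
      using u0 by (simp add: field_simps)
    then have "cmod (y - u * x) = cmod u * cmod (inverse u * y - x)"
      by (simp add: norm_mult)
    then show ?thesis using u by (simp add: \<phi>_def indicator_def)
  qed
  have "N * V = (\<integral>\<^sup>+y. \<phi> y * (\<integral>\<^sup>+x. g (u * x) \<partial>lborel) \<partial>lborel)"
    unfolding N_def V_def by (simp add: nn_integral_multc mult.commute)
  \<comment> \<open>Translating x by \<open>inverse u * y\<close> turns the argument of
    \<open>g\<close> into \<open>y + u * x\<close>. Translating y by \<open>- (u * x)\<close> then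
    frees \<open>g\<close> of x, and only \<open>\<phi>\<close> still sees the rotation;
    \<open>rad\<close> removes it there.\<close>
  also have "\<dots> = (\<integral>\<^sup>+y. (\<integral>\<^sup>+x. \<phi> y * g (u * (inverse u * y + x)) \<partial>lborel) \<partial>lborel)"
    by (subst nn_integral_cmult[symmetric])
       (auto simp: nn_integral_cmult nn_integral_lborel_translate[of "\<lambda>x. g (u * x)"])
  also have "\<dots> = (\<integral>\<^sup>+x. (\<integral>\<^sup>+y. \<phi> y * g (u * (inverse u * y + x)) \<partial>lborel) \<partial>lborel)"
    by (rule lborel_pair.Fubini') measurable
  also have "\<dots> = (\<integral>\<^sup>+x. (\<integral>\<^sup>+y. \<phi> ((- (u * x)) + y) * g y \<partial>lborel) \<partial>lborel)"
  proof (rule nn_integral_cong)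
    fix x :: complex
    have "(\<integral>\<^sup>+y. \<phi> y * g (u * (inverse u * y + x)) \<partial>lborel)
        = (\<integral>\<^sup>+y. (\<lambda>y. \<phi> y * g (u * (inverse u * y + x))) (- (u * x) + y) \<partial>lborel)"
      by (rule nn_integral_lborel_translate[symmetric]) measurable
    also have "\<dots> = (\<integral>\<^sup>+y. \<phi> ((- (u * x)) + y) * g y \<partial>lborel)"
      using u0 by (simp add: field_simps)
    finally show "(\<integral>\<^sup>+y. \<phi> y * g (u * (inverse u * y + x)) \<partial>lborel) = \<dots>" .
  qed
  also have "\<dots> = (\<integral>\<^sup>+y. (\<integral>\<^sup>+x. \<phi> ((- (u * x)) + y) * g y \<partial>lborel) \<partial>lborel)"
    by (rule lborel_pair.Fubini') measurable
  also have "\<dots> = (\<integral>\<^sup>+y. g y * (\<integral>\<^sup>+x. \<phi> (- (inverse u * y) + x) \<partial>lborel) \<partial>lborel)"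
  proof (rule nn_integral_cong)
    fix y :: complex
    have "\<phi> ((- (u * x)) + y) = \<phi> (- (inverse u * y) + x)" for x
      using rad[of y x] by (auto simp: \<phi>_def indicator_def norm_minus_commute)
    then show "(\<integral>\<^sup>+x. \<phi> ((- (u * x)) + y) * g y \<partial>lborel)
      = g y * (\<integral>\<^sup>+x. \<phi> (- (inverse u * y) + x) \<partial>lborel)"
      by (subst nn_integral_cmult[symmetric]) (auto simp: mult.commute)
  qed
  also have "\<dots> = (\<integral>\<^sup>+y. g y * V \<partial>lborel)"
    unfolding V_def by (subst nn_integral_lborel_translate) auto
  also have "\<dots> = (\<integral>\<^sup>+y. g y \<partial>lborel) * V"
    by (simp add: nn_integral_multc)
  finally have "N * V = (\<integral>\<^sup>+y. g y \<partial>lborel) * V" .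
  then show ?thesis
    using V0 unfolding N_def by (metis ennreal_mult_divide_eq infinity_ennreal_def)
qed

lemma nn_integral_cis_shift:
  fixes g :: "complex \<Rightarrow> ennreal"
  assumes [measurable]: "g \<in> borel_measurable borel" and s: "0 \<le> s" "s \<le> 2 * pi"
  shows "(\<integral>\<^sup>+t\<in>{0..2*pi}. g (cis (s + t)) \<partial>lborel) = (\<integral>\<^sup>+t\<in>{0..2*pi}. g (cis t) \<partial>lborel)"
proof -
  have [measurable]: "cis \<in> borel_measurable borel"
    by (intro borel_measurable_continuous_onI continuous_intros)
  have "(\<integral>\<^sup>+t\<in>{0..2*pi}. g (cis (s + t)) \<partial>lborel)
      = (\<integral>\<^sup>+t. (\<lambda>t. g (cis t) * indicator {s..2*pi+s} t) (s + t) \<partial>lborel)"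
    by (auto intro!: nn_integral_cong simp: indicator_def)
  also have "\<dots> = (\<integral>\<^sup>+t\<in>{s..2*pi+s}. g (cis t) \<partial>lborel)"
    by (rule nn_integral_lborel_translate) measurable
  also have "\<dots> = (\<integral>\<^sup>+t. g (cis t) * indicator {s..<2*pi} t + g (cis t) * indicator {2*pi..2*pi+s} t \<partial>lborel)"
    using s by (intro nn_integral_cong) (auto simp: indicator_def)
  also have "\<dots> = (\<integral>\<^sup>+t\<in>{s..<2*pi}. g (cis t) \<partial>lborel) + (\<integral>\<^sup>+t\<in>{2*pi..2*pi+s}. g (cis t) \<partial>lborel)"
    by (rule nn_integral_add) measurable
  also have "(\<integral>\<^sup>+t\<in>{2*pi..2*pi+s}. g (cis t) \<partial>lborel)
      = (\<integral>\<^sup>+t. (\<lambda>t. g (cis t) * indicator {2*pi..2*pi+s} t) (2*pi + t) \<partial>lborel)"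
    by (rule nn_integral_lborel_translate[symmetric]) measurable
  also have "\<dots> = (\<integral>\<^sup>+t\<in>{0..s}. g (cis t) \<partial>lborel)"
    by (auto intro!: nn_integral_cong simp: indicator_def cis_mult[symmetric])
  also have "(\<integral>\<^sup>+t\<in>{s..<2*pi}. g (cis t) \<partial>lborel) + \<dots>
     = (\<integral>\<^sup>+t. g (cis t) * indicator {s..<2*pi} t + g (cis t) * indicator {0..s} t \<partial>lborel)"
    by (rule nn_integral_add[symmetric]) measurable
  \<comment> \<open>The two pieces together differ from \<open>{0..2*pi}\<close> at most in the
    points \<open>s\<close> and \<open>2*pi\<close>, a null set.\<close>
  also have "\<dots> = (\<integral>\<^sup>+t\<in>{0..2*pi}. g (cis t) \<partial>lborel)"
    using s
    by (intro nn_integral_cong_AE, use AE_lborel_singleton[of s] AE_lborel_singleton[of "2*pi"] in eventually_elim)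
       (auto simp: indicator_def)
  finally show ?thesis .
qed

text \<open>Polar coordinates without a Jacobian: the integral is unchanged when \<open>g\<close> is
  rotated, so it equals its own mean over the angle, and Fubini carries that mean inside. The radial
  factor is not affected.\<close>

lemma nn_integral_circle_average:
  fixes g :: "complex \<Rightarrow> ennreal" and \<phi> :: "real \<Rightarrow> ennreal"
  assumes g[measurable]: "g \<in> borel_measurable borel" and [measurable]: "\<phi> \<in> borel_measurable borel"
  shows "(\<integral>\<^sup>+z. \<phi> (cmod z) * g z \<partial>lborel)
    = (\<integral>\<^sup>+z. \<phi> (cmod z) * ((\<integral>\<^sup>+t\<in>{0..2*pi}. g (cmod z * cis t) \<partial>lborel) / ennreal (2*pi)) \<partial>lborel)"
proof -
  have cis[measurable]: "cis \<in> borel_measurable borel"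
    by (intro borel_measurable_continuous_onI continuous_intros)
  define I where "I = (\<integral>\<^sup>+z. \<phi> (cmod z) * g z \<partial>lborel)"
  have rot: "(\<integral>\<^sup>+z. \<phi> (cmod z) * g (cis t * z) \<partial>lborel) = I" for t
    using nn_integral_lborel_rotate[of "\<lambda>z. \<phi> (cmod z) * g z" "cis t"] 
    by (simp add: I_def norm_mult)
  have "I * ennreal (2*pi) = (\<integral>\<^sup>+t\<in>{0..2*pi}. I \<partial>lborel)"
    by (subst nn_integral_cmult_indicator) auto
  also have "\<dots> = (\<integral>\<^sup>+t. (\<integral>\<^sup>+z. \<phi> (cmod z) * g (cis t * z) * indicator {0..2*pi} t \<partial>lborel) \<partial>lborel)"
    by (simp add: rot nn_integral_multc)
  also have "\<dots> = (\<integral>\<^sup>+z. (\<integral>\<^sup>+t. \<phi> (cmod z) * g (cis t * z) * indicator {0..2*pi} t \<partial>lborel) \<partial>lborel)"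
    by (rule lborel_pair.Fubini') measurable
  also have "\<dots> = (\<integral>\<^sup>+z. \<phi> (cmod z) * (\<integral>\<^sup>+t\<in>{0..2*pi}. g (cmod z * cis t) \<partial>lborel) \<partial>lborel)"
  proof (rule nn_integral_cong)
    fix z :: complex
    have z: "z = cmod z * cis (Arg2pi z)"
      using Arg2pi[of z] by (simp add: cis_conv_exp is_Arg_def)
    have "g (cis t * z) = (\<lambda>w. g (cmod z * w)) (cis (Arg2pi z + t))" for t
      by (subst z) (simp add: cis_mult[symmetric] ac_simps)
    then have "(\<integral>\<^sup>+t\<in>{0..2*pi}. g (cis t * z) \<partial>lborel) = (\<integral>\<^sup>+t\<in>{0..2*pi}. g (cmod z * cis t) \<partial>lborel)"
      using nn_integral_cis_shift[of "\<lambda>w. g (cmod z * w)" "Arg2pi z"] Arg2pi[of z] by simp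
    then show "(\<integral>\<^sup>+t. \<phi> (cmod z) * g (cis t * z) * indicator {0..2*pi} t \<partial>lborel)
      = \<phi> (cmod z) * (\<integral>\<^sup>+t\<in>{0..2*pi}. g (cmod z * cis t) \<partial>lborel)"
      by (simp add: nn_integral_cmult mult.assoc)
  qed
  finally have I: "I * ennreal (2*pi) = (\<integral>\<^sup>+z. \<phi> (cmod z) * (\<integral>\<^sup>+t\<in>{0..2*pi}. g (cmod z * cis t) \<partial>lborel) \<partial>lborel)" .
  have "I = I * ennreal (2*pi) / ennreal (2*pi)"
    by (simp add: ennreal_mult_divide_eq)
  also have "\<dots> = (\<integral>\<^sup>+z. \<phi> (cmod z) * (\<integral>\<^sup>+t\<in>{0..2*pi}. g (cmod z * cis t) \<partial>lborel) / ennreal (2*pi) \<partial>lborel)"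
    unfolding I by (subst nn_integral_divide) auto
  finally show ?thesis
    by (simp add: I_def ennreal_times_divide)
qed

text \<open>Superlevel sets are open by lower semicontinuity. Nothing is known of
  \<open>\<omega>\<close> off \<open>S\<close>, hence the indicator; the value 0 that it creates
  never exceeds a level \<open>c\<close> in \<open>ennreal\<close>.\<close>

lemma borel_measurable_lsc_ennreal:
  fixes \<omega> :: "complex \<Rightarrow> ennreal"
  assumes S: "open S" and lsc: "\<And>z. z \<in> S \<Longrightarrow> \<omega> z \<le> Liminf (at z) \<omega>"
  shows "(\<lambda>z. \<omega> z * indicator S z) \<in> borel_measurable borel"
proof (rule borel_measurableI_greater)
  fix c :: ennreal
  have "open {z\<in>S. c < \<omega> z}"
  proof (rule openI)
    fix z assume z: "z \<in> {z\<in>S. c < \<omega> z}"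
    then have "c < Liminf (at z) \<omega>" using lsc[of z] by auto
    then have "\<forall>\<^sub>F x in at z. c < \<omega> x"
      by (rule less_LiminfD)
    moreover have "\<forall>\<^sub>F x in at z. x \<in> S"
      using z S by (auto intro: eventually_at_in_open')
    ultimately have "\<forall>\<^sub>F x in at z. x \<in> {z\<in>S. c < \<omega> z}" by eventually_elim auto
    then have "\<forall>\<^sub>F x in nhds z. x \<in> {z\<in>S. c < \<omega> z}"
      using z by (simp add: eventually_at_filter eventually_mono) (auto elim: eventually_mono)
    then obtain T where "open T" "z \<in> T" "T \<subseteq> {z\<in>S. c < \<omega> z}"
      unfolding eventually_nhds by blast
    then show "\<exists>e>0. ball z e \<subseteq> {z\<in>S. c < \<omega> z}"
      by (metis openE order_trans)
  qed
  moreover have "{z \<in> space borel. c < \<omega> z * indicator S z} = {z\<in>S. c < \<omega> z}"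
    by (auto simp: indicator_def split: if_splits)
  ultimately show "{z \<in> space borel. c < \<omega> z * indicator S z} \<in> sets borel"
    by simp
qed

subsection \<open>Superharmonic weights\<close>

lemma superharmonic_weight_measurable:
  assumes "superharmonic_weight \<omega>"
  shows "(\<lambda>z. \<omega> z * indicator unit_disk z) \<in> borel_measurable borel"
  using assms by (intro borel_measurable_lsc_ennreal) (auto simp: superharmonic_weight_def)

lemma superharmonic_weight_mean:
  assumes "superharmonic_weight \<omega>" "0 < r" "cball a r \<subseteq> unit_disk"
  shows "(\<integral>\<^sup>+t\<in>{0..2*pi}. \<omega> (a + complex_of_real r * cis t) * indicator unit_disk (a + complex_of_real r * cis t) \<partial>lborel)
    / ennreal (2*pi) \<le> \<omega> a"
proof -
  have "a + complex_of_real r * cis t \<in> unit_disk" for t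
    using assms(2,3) by (intro subsetD[OF assms(3)]) (auto simp: dist_norm norm_mult)
  then have "(\<integral>\<^sup>+t\<in>{0..2*pi}. \<omega> (a + complex_of_real r * cis t) * indicator unit_disk (a + complex_of_real r * cis t) \<partial>lborel)
     = (\<integral>\<^sup>+t\<in>{0..2*pi}. \<omega> (a + complex_of_real r * cis t) \<partial>lborel)"
    by simp
  then show ?thesis
    using assms unfolding superharmonic_weight_def by auto
qed

text \<open>The area integral is an integral of circle means about \<open>b\<close>, each at most
  \<open>\<omega> b\<close>. The radius 0, to which the mean inequality does not apply, belongs to a
  single point.\<close>

lemma nn_integral_cball_superharmonic_le:
  assumes w: "superharmonic_weight \<omega>" and R: "cball b R \<subseteq> unit_disk"
  shows "(\<integral>\<^sup>+z\<in>cball b R. \<omega> z \<partial>lborel) \<le> \<omega> b * emeasure lborel (cball (0::complex) R)"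
proof -
  define W where "W = (\<lambda>z. \<omega> z * indicator unit_disk z)"
  have [measurable]: "W \<in> borel_measurable borel"
    unfolding W_def by (rule superharmonic_weight_measurable[OF w])
  have [measurable]: "cball b R \<in> sets borel" by simp
  have "(\<integral>\<^sup>+z\<in>cball b R. \<omega> z \<partial>lborel) = (\<integral>\<^sup>+z. W z * indicator (cball b R) z \<partial>lborel)"
    using R by (intro nn_integral_cong) (auto simp: W_def indicator_def)
  also have "\<dots> = (\<integral>\<^sup>+z. W (b + z) * indicator (cball b R) (b + z) \<partial>lborel)"
    by (subst nn_integral_lborel_translate[of "\<lambda>z. W z * indicator (cball b R) z" b]) measurable
  also have "\<dots> = (\<integral>\<^sup>+z. indicator {..R} (cmod z) * W (b + z) \<partial>lborel)"
    by (intro nn_integral_cong) (auto simp: indicator_def dist_norm)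
  also have "\<dots> = (\<integral>\<^sup>+z. indicator {..R} (cmod z) * ((\<integral>\<^sup>+t\<in>{0..2*pi}. W (b + cmod z * cis t) \<partial>lborel) / ennreal (2*pi)) \<partial>lborel)"
    by (rule nn_integral_circle_average) measurable
  also have "\<dots> \<le> (\<integral>\<^sup>+z. \<omega> b * indicator (cball (0::complex) R) z \<partial>lborel)"
  proof (rule nn_integral_mono_AE, rule AE_mp[OF AE_lborel_singleton[of 0]], rule AE_I2, rule impI)
    fix z :: complex assume z: "z \<noteq> 0"
    show "indicator {..R} (cmod z) * ((\<integral>\<^sup>+t\<in>{0..2*pi}. W (b + cmod z * cis t) \<partial>lborel) / ennreal (2*pi))
      \<le> \<omega> b * indicator (cball 0 R) z"
    proof (cases "cmod z \<le> R")
      case True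
      then have "cball b (cmod z) \<subseteq> unit_disk" using R by auto
      then show ?thesis
        using superharmonic_weight_mean[OF w, of "cmod z" b] z True by (auto simp: W_def)
    qed auto
  qed
  also have "\<dots> = \<omega> b * emeasure lborel (cball (0::complex) R)"
    by (rule nn_integral_cmult_indicator) auto
  finally show ?thesis .
qed

text \<open>The definition grants one finite point, anywhere in the disk. If all finite points kept
  a distance \<open>r > 0\<close> from 0, a disk about an almost nearest one would reach into
  \<open>ball 0 r\<close>, where \<open>\<omega>\<close> is infinite, and its area mean could not be
  finite.\<close>

lemma superharmonic_weight_finite_point:
  assumes w: "superharmonic_weight \<omega>" and e: "e > 0"
  shows "\<exists>b\<in>unit_disk. cmod b < e \<and> \<omega> b < \<infinity>"
proof -
  define S where "S = cmod ` {b\<in>unit_disk. \<omega> b < \<infinity>}"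
  have S: "S \<noteq> {}" using w unfolding S_def superharmonic_weight_def by auto
  have bdd: "bdd_below S" unfolding S_def by (auto intro!: bdd_belowI[of _ 0])
  define r where "r = Inf S"
  have r0: "r \<ge> 0" unfolding r_def by (rule cInf_greatest[OF S]) (auto simp: S_def)
  have r_le: "r \<le> cmod b" if "b \<in> unit_disk" "\<omega> b < \<infinity>" for b
    unfolding r_def using that by (intro cInf_lower bdd) (auto simp: S_def)
  have r1: "r < 1"
  proof -
    obtain b where "b \<in> unit_disk" "\<omega> b < \<infinity>" using S by (auto simp: S_def)
    then show ?thesis using r_le[of b] by auto
  qed
  have "r = 0"
  proof (rule ccontr)
    assume "r \<noteq> 0"
    then have r: "r > 0" using r0 by simp
    \<comment> \<open>This choice gives k \<ge> 7 (1 - r) / 16 below, so shrinking \<open>b\<close>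
      by the factor 1 - k lowers the modulus by at least 7 r (1 - r) / 16, more than the excess d =
      2 r (1 - r) / 16.\<close>
    define d where "d = r * (1 - r) / 8"
    have d: "d > 0" using r r1 by (simp add: d_def)
    have "Inf S < r + d" using d by (simp add: r_def)
    then obtain b where b: "b \<in> unit_disk" "\<omega> b < \<infinity>" "cmod b < r + d"
      using S bdd by (auto simp: cInf_less_iff S_def)
    \<comment> \<open>Half the distance from \<open>b\<close> to the unit circle, so that
      \<open>cball b k\<close> stays in the disk; the point \<open>c\<close> below lies at distance
      k |b| < k from \<open>b\<close>.\<close>
    define k where "k = (1 - cmod b) / 2"
    have k: "k > 0" "k < 1" using b(1) norm_ge_zero[of b] by (simp_all add: k_def del: norm_ge_zero)
    have "d \<le> (1 - r) / 8" using r r1 unfolding d_def by (simp add: mult_left_le_one_le)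
    then have k2: "k \<ge> (1 - r) * 7 / 16" using b(3) by (simp add: k_def)
    define c where "c = of_real (1 - k) * b"
    have "cmod c = cmod b - k * cmod b"
      unfolding c_def norm_mult norm_of_real using k by (simp add: algebra_simps)
    also have "\<dots> \<le> cmod b - k * r"
      using r_le[OF b(1,2)] k by simp
    also have "\<dots> < r + d - k * r" using b(3) by simp
    also have "\<dots> \<le> r + d - ((1 - r) * 7 / 16) * r"
      using mult_right_mono[OF k2, of r] r by linarith
    also have "\<dots> < r"
    proof -
      have "r * (1 - r) > 0" using r r1 by simp
      moreover have "((1 - r) * 7 / 16) * r = (r * (1 - r)) * 7 / 16" by simp
      ultimately show ?thesis unfolding d_def by linarith
    qed
    finally have c: "cmod c < r" .
    have "b - c = of_real k * b" by (simp add: c_def algebra_simps)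
    then have "cmod (b - c) = k * cmod b" using k by (simp add: norm_mult)
    also have "\<dots> < k * 1" using b(1) k by (intro mult_strict_left_mono) auto
    finally have "c \<in> ball b k \<inter> ball 0 r" using c by (auto simp: dist_norm)
    then obtain \<epsilon> where \<epsilon>: "\<epsilon> > 0" "ball c \<epsilon> \<subseteq> ball b k \<inter> ball 0 r"
      by (meson open_Int open_ball openE)
    have sub: "cball b k \<subseteq> unit_disk"
    proof
      fix z assume "z \<in> cball b k"
      then have "cmod z \<le> cmod b + k" using norm_triangle_sub[of z b] by (auto simp: dist_norm norm_minus_commute)
      also have "\<dots> < 1" using b(1) by (simp add: k_def field_simps)
      finally show "z \<in> unit_disk" by simp
    qed
    have inf: "\<omega> z = \<infinity>" if "z \<in> ball c \<epsilon>" for z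
    proof (rule ccontr)
      assume "\<omega> z \<noteq> \<infinity>"
      then have "\<omega> z < \<infinity>" by (simp add: top.not_eq_extremum)
      moreover have "z \<in> unit_disk" "cmod z < r"
        using that \<epsilon>(2) sub by (auto dest!: subsetD)
      ultimately show False using r_le[of z] by auto
    qed
    have "\<infinity> * emeasure lborel (ball c \<epsilon>) = (\<integral>\<^sup>+z. \<infinity> * indicator (ball c \<epsilon>) z \<partial>lborel)"
      by (rule nn_integral_cmult_indicator[symmetric]) auto
    also have "\<dots> \<le> (\<integral>\<^sup>+z\<in>cball b k. \<omega> z \<partial>lborel)"
      using inf \<epsilon>(2) by (intro nn_integral_mono) (auto simp: indicator_def dest!: subsetD)
    also have "\<dots> \<le> \<omega> b * emeasure lborel (cball (0::complex) k)"
      by (rule nn_integral_cball_superharmonic_le[OF w sub])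
    also have "\<dots> < \<infinity>"
      using b(2) emeasure_lborel_cball_finite[of "0::complex" k] by (simp add: ennreal_mult_less_top)
    finally have "\<infinity> * emeasure lborel (ball c \<epsilon>) < \<infinity>" .
    moreover have "emeasure lborel (ball c \<epsilon>) \<noteq> 0"
      using \<epsilon>(1) by (auto simp: emeasure_ball eval_unit_ball_vol)
    ultimately show False by (simp add: ennreal_top_mult)
  qed
  then have "Inf S < e" using e by (simp add: r_def)
  then show ?thesis using S bdd by (auto simp: cInf_less_iff S_def)
qed

text \<open>One disk about a finite point \<open>b\<close> covers \<open>ball 0 \<rho>\<close>. It
  must also stay inside the unit disk, which is why \<open>b\<close> has to be close to 0: one third
  of the gap 1 - \<rho> pays for |b|, another for the enlarged radius.\<close>

lemma superharmonic_weight_locally_integrable: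
  assumes w: "superharmonic_weight \<omega>" and \<rho>: "\<rho> < 1"
  shows "(\<integral>\<^sup>+z\<in>ball 0 \<rho>. \<omega> z \<partial>lborel) < \<infinity>"
proof -
  obtain b where b: "b \<in> unit_disk" "cmod b < (1 - \<rho>) / 3" "\<omega> b < \<infinity>"
    using superharmonic_weight_finite_point[OF w, of "(1 - \<rho>) / 3"] \<rho> by auto
  define R where "R = \<rho> + (1 - \<rho>) / 3"
  have sub: "cball b R \<subseteq> unit_disk"
  proof
    fix z assume "z \<in> cball b R"
    then have "cmod z \<le> cmod b + R" using norm_triangle_sub[of z b] by (auto simp: dist_norm norm_minus_commute)
    also have "\<dots> < 1" using b(2) \<rho> by (simp add: R_def field_simps)
    finally show "z \<in> unit_disk" by simp
  qed
  have sub': "z \<in> cball b R" if "z \<in> ball 0 \<rho>" for z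
    using that b(2) norm_triangle_ineq4[of b z] by (simp add: dist_norm R_def field_simps)
  have "(\<integral>\<^sup>+z\<in>ball 0 \<rho>. \<omega> z \<partial>lborel) \<le> (\<integral>\<^sup>+z\<in>cball b R. \<omega> z \<partial>lborel)"
    using sub' by (intro nn_integral_mono) (auto simp: indicator_def)
  also have "\<dots> \<le> \<omega> b * emeasure lborel (cball (0::complex) R)"
    by (rule nn_integral_cball_superharmonic_le[OF w sub])
  also have "\<dots> < \<infinity>"
    using b(3) emeasure_lborel_cball_finite[of "0::complex" R] by (simp add: ennreal_mult_less_top)
  finally show ?thesis .
qed

subsection \<open>Concavity of the shift\<close>

lemma has_integral_trig_zero:
  "((\<lambda>t. Re (a * cis t + b * (cis t)\<^sup>2)) has_integral 0) {0..2*pi}"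
proof -
  define F where "F = (\<lambda>t. Re a * sin t + Im a * cos t + Re b * sin (2 * t) / 2 + Im b * cos (2 * t) / 2)"
  have "((\<lambda>t. Re (a * cis t + b * (cis t)\<^sup>2)) has_integral (F (2*pi) - F 0)) {0..2*pi}"
  proof (rule fundamental_theorem_of_calculus)
    fix t assume "t \<in> {0..2*pi}"
    have "(F has_real_derivative Re a * cos t - Im a * sin t + (Re b * cos (2 * t) - Im b * sin (2 * t))) (at t within {0..2*pi})"
      unfolding F_def by (auto intro!: derivative_eq_intros)
    moreover have "Re (a * cis t + b * (cis t)\<^sup>2) = Re a * cos t - Im a * sin t + Re b * cos (2 * t) - Im b * sin (2 * t)"
      by (simp add: power2_eq_square cis_mult)
    ultimately show "(F has_vector_derivative Re (a * cis t + b * (cis t)\<^sup>2)) (at t within {0..2*pi})"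
      by (simp add: has_real_derivative_iff_has_vector_derivative)
  qed auto
  moreover have "F (2*pi) - F 0 = 0"
    using cos_2npi[of 2] sin_2npi[of 2] by (simp add: F_def)
  ultimately show ?thesis by simp
qed

text \<open>Square the second Taylor polynomial. On the circle |\<zeta>| = r its constant part is
  |h|^2 + r^2 |h'|^2 up to order r^4, and the rest is harmonic in \<zeta>: the cross term of degrees
  1 and 2 becomes a multiple of \<zeta> because \<zeta> times its conjugate is r^2. The coefficients
  \<alpha>, \<beta> may depend on z and r since they integrate to zero over the circle, but
  \<open>C\<close> is uniform.\<close>

lemma holomorphic_cmod_square_expansion:
  assumes h: "h holomorphic_on ball 0 1" and R: "R < 1"
  shows "\<exists>C\<ge>0. \<forall>z r. cmod z \<le> R \<longrightarrow> (\<exists>\<alpha> \<beta>. \<forall>\<zeta>. cmod \<zeta> = r \<longrightarrow> cmod (z - \<zeta>) \<le> R \<longrightarrow>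
      \<bar>(cmod (h (z - \<zeta>)))\<^sup>2 - (cmod (h z))\<^sup>2 - r\<^sup>2 * (cmod (deriv h z))\<^sup>2 - Re (\<alpha> * \<zeta> + \<beta> * \<zeta>\<^sup>2)\<bar> \<le> C * r ^ 3)"
proof -
  have sub: "cball 0 R \<subseteq> ball (0::complex) 1" using R by auto
  have hol: "(deriv ^^ i) h holomorphic_on ball 0 1" for i
    by (rule holomorphic_higher_deriv[OF h]) auto
  have "\<exists>M. \<forall>z\<in>cball 0 R. cmod ((deriv ^^ i) h z) \<le> M" for i
  proof -
    have "compact ((deriv ^^ i) h ` cball 0 R)"
      using holomorphic_on_imp_continuous_on[OF hol[of i]] sub
      by (intro compact_continuous_image) (auto intro: continuous_on_subset)
    then have "bounded ((deriv ^^ i) h ` cball 0 R)" by (rule compact_imp_bounded)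
    then show ?thesis by (auto simp: bounded_iff)
  qed
  then obtain M' where M': "\<And>i z. cmod z \<le> R \<Longrightarrow> cmod ((deriv ^^ i) h z) \<le> M' i"
    by (metis mem_cball_0)
  define M where "M = max 0 (Max (M' ` {..3}))"
  have M0: "M \<ge> 0" by (simp add: M_def)
  have M: "cmod ((deriv ^^ i) h z) \<le> M" if "cmod z \<le> R" "i \<le> 3" for i z
  proof -
    have "M' i \<le> Max (M' ` {..3})" using that(2) by (intro Max_ge) auto
    then show ?thesis using M'[OF that(1), of i] by (simp add: M_def)
  qed
  \<comment> \<open>Three of the four M^2 come from the Taylor remainder, by |A|^2 - |P|^2 = (|A| -
    |P|)(|A| + |P|); the fourth absorbs the term |e|^2 r^4, using r \<le> 2.\<close>
  have "\<bar>(cmod (h (z - \<zeta>)))\<^sup>2 - (cmod (h z))\<^sup>2 - r\<^sup>2 * (cmod (deriv h z))\<^sup>2 -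
      Re ((- 2 * cnj (h z) * deriv h z - cnj (deriv h z) * (deriv ^^ 2) h z * of_real (r\<^sup>2)) * \<zeta>
         + (cnj (h z) * (deriv ^^ 2) h z) * \<zeta>\<^sup>2)\<bar> \<le> (4 * M\<^sup>2) * r ^ 3"
    if z: "cmod z \<le> R" and r: "cmod \<zeta> = r" and zz: "cmod (z - \<zeta>) \<le> R" for z \<zeta> r
  proof -
    define x where "x = h z"
    define y where "y = deriv h z"
    define e where "e = (deriv ^^ 2) h z / 2"
    define A where "A = h (z - \<zeta>)"
    define P where "P = x - y * \<zeta> + e * \<zeta>\<^sup>2"
    have r0: "r \<ge> 0" using r by auto
    have r2: "r \<le> 2"
    proof -
      have "r \<le> cmod z + cmod (z - \<zeta>)"
        using norm_triangle_ineq4[of z "z - \<zeta>"] r by simp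
      then show ?thesis using z zz R by linarith
    qed
    have b: "cmod x \<le> M" "cmod y \<le> M" "cmod e \<le> M / 2" "cmod A \<le> M"
      using M[OF z, of 0] M[OF z, of 1] M[OF z, of 2] M[OF zz, of 0]
      by (auto simp: x_def y_def e_def A_def norm_divide)
    have "cmod ((deriv ^^ 0) h (z - \<zeta>) - (\<Sum>i\<le>2. (deriv ^^ i) h z * ((z - \<zeta>) - z) ^ i / fact i))
        \<le> M * cmod ((z - \<zeta>) - z) ^ Suc 2 / fact 2"
    proof (rule complex_Taylor[where S = "cball 0 R"])
      fix i :: nat and w :: complex assume w: "w \<in> cball 0 R" "i \<le> 2"
      have "((deriv ^^ i) h has_field_derivative deriv ((deriv ^^ i) h) w) (at w)"
        using sub w by (intro holomorphic_derivI[OF hol[of i]]) auto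
      then show "((deriv ^^ i) h has_field_derivative (deriv ^^ Suc i) h w) (at w within cball 0 R)"
        by (auto intro: has_field_derivative_at_within)
    qed (use z zz M in auto)
    also have "(\<Sum>i\<le>2. (deriv ^^ i) h z * ((z - \<zeta>) - z) ^ i / fact i) = P"
      by (simp add: P_def x_def y_def e_def numeral_2_eq_2)
    finally have AP: "cmod (A - P) \<le> M * r ^ 3 / 2"
      using r by (simp add: A_def numeral_eq_Suc)
    have Pb: "cmod P \<le> 5 * M"
    proof -
      have "cmod P \<le> cmod x + cmod y * r + cmod e * r\<^sup>2"
        unfolding P_def using r
        by (smt (verit, best) norm_mult norm_power norm_triangle_ineq norm_triangle_ineq4)
      moreover have "cmod y * r \<le> M * 2" using b r0 r2 M0 by (intro mult_mono) auto
      moreover have "cmod e * r\<^sup>2 \<le> (M/2) * 2\<^sup>2" using b r0 r2 M0 by (intro mult_mono power_mono) auto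
      ultimately show ?thesis using b by simp
    qed
    have "\<bar>(cmod A)\<^sup>2 - (cmod P)\<^sup>2\<bar> = \<bar>cmod A - cmod P\<bar> * (cmod A + cmod P)"
      by (simp add: power2_eq_square square_diff_square_factored abs_mult)
    also have "\<dots> \<le> (M * r ^ 3 / 2) * (M + 5 * M)"
      using AP b(4) Pb norm_triangle_ineq3[of A P] M0 r0 by (intro mult_mono) auto
    also have "\<dots> = 3 * M\<^sup>2 * r ^ 3" by (simp add: power2_eq_square)
    finally have AP2: "\<bar>(cmod A)\<^sup>2 - (cmod P)\<^sup>2\<bar> \<le> 3 * M\<^sup>2 * r ^ 3" .
    have e2: "(cmod e)\<^sup>2 * r ^ 4 \<le> M\<^sup>2 * r ^ 3"
    proof -
      have "(cmod e)\<^sup>2 * r ^ 4 \<le> (M/2)\<^sup>2 * (2 * r ^ 3)"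
        using b(3) r0 r2 M0 by (intro mult_mono power_mono) (auto simp: numeral_eq_Suc mult_right_mono)
      also have "\<dots> \<le> M\<^sup>2 * r ^ 3" using r0 M0 by (simp add: power2_eq_square field_simps)
      finally show ?thesis .
    qed
    have id: "(cmod P)\<^sup>2 = (cmod x)\<^sup>2 + r\<^sup>2 * (cmod y)\<^sup>2 + (cmod e)\<^sup>2 * r ^ 4
        + Re ((- 2 * cnj x * y - cnj y * (2 * e) * of_real (r\<^sup>2)) * \<zeta> + (cnj x * (2 * e)) * \<zeta>\<^sup>2)"
    proof -
      have r2': "r\<^sup>2 = (Re \<zeta>)\<^sup>2 + (Im \<zeta>)\<^sup>2" using r cmod_power2[of \<zeta>] by simp
      have r4: "r ^ 4 = ((Re \<zeta>)\<^sup>2 + (Im \<zeta>)\<^sup>2)\<^sup>2"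
        unfolding r2'[symmetric] by simp
      show ?thesis
        unfolding cmod_power2 r4 r2' P_def by (simp add: power2_eq_square algebra_simps)
    qed
    have e': "(deriv ^^ 2) h z = 2 * e" by (simp add: e_def)
    have e0: "0 \<le> (cmod e)\<^sup>2 * r ^ 4" using r0 by simp
    show ?thesis
      unfolding e' x_def[symmetric] y_def[symmetric] A_def[symmetric]
      using AP2 e2 e0 id by (simp only: abs_le_iff) linarith
  qed
  then show ?thesis
    by (intro exI[of _ "4 * M\<^sup>2"] conjI allI impI) (simp, metis)
qed

text \<open>The trigonometric part has mean zero, so a pointwise bound becomes a bound on the mean.
  For negative \<open>m\<close> the left side is truncated to 0.\<close>

lemma circle_mean_lower_bound:
  assumes cont: "continuous_on {0..2*pi} f" and nonneg: "\<And>t. 0 \<le> f t"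
    and lower: "\<And>t. m + Re (a * cis t + b * (cis t)\<^sup>2) \<le> f t"
  shows "ennreal m \<le> (\<integral>\<^sup>+t\<in>{0..2*pi}. ennreal (f t) \<partial>lborel) / ennreal (2*pi)"
proof -
  obtain I where I: "(f has_integral I) {0..2*pi}"
    using integrable_continuous_interval[OF cont] by (auto simp: integrable_on_def)
  have "((\<lambda>t. m + Re (a * cis t + b * (cis t)\<^sup>2)) has_integral (2 * pi * m + 0)) {0..2*pi}"
    by (intro has_integral_add has_integral_trig_zero) (use has_integral_const_real[of m 0 "2*pi"] in simp)
  then have "2 * pi * m + 0 \<le> I"
    using I lower by (rule has_integral_le)
  then have m: "m \<le> I / (2 * pi)" by (simp add: field_simps)
  have "(\<integral>\<^sup>+t\<in>{0..2*pi}. ennreal (f t) \<partial>lborel) = (\<integral>\<^sup>+t. ennreal (indicator {0..2*pi} t * f t) \<partial>lborel)"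
    by (intro nn_integral_cong) (auto simp: indicator_def)
  also have "\<dots> = ennreal I"
    using I nonneg by (intro nn_integral_has_integral_lebesgue) auto
  moreover have "I \<ge> 0" using I nonneg by (rule has_integral_nonneg)
  ultimately show ?thesis
    using m by (simp add: divide_ennreal ennreal_leI)
qed

text \<open>Averaging over circles is self-adjoint with respect to Lebesgue measure, so the mean
  passes from \<open>u\<close> to the weight, where superharmonicity bounds it. The condition
  \<open>r + \<rho> \<le> 1\<close> keeps the circles about points of the support inside the
  disk.\<close>

lemma superharmonic_convolution_le:
  assumes w: "superharmonic_weight \<omega>" and r: "0 < r" "r + \<rho> \<le> 1"
    and u[measurable]: "u \<in> borel_measurable borel" and supp: "\<And>z. z \<notin> ball 0 \<rho> \<Longrightarrow> u z = 0"
  shows "(\<integral>\<^sup>+z\<in>unit_disk. \<omega> z * ((\<integral>\<^sup>+t\<in>{0..2*pi}. u (z - of_real r * cis t) \<partial>lborel) / ennreal (2*pi)) \<partial>lborel)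
     \<le> (\<integral>\<^sup>+z\<in>ball 0 \<rho>. \<omega> z * u z \<partial>lborel)"
proof -
  define W where "W = (\<lambda>z. \<omega> z * indicator unit_disk z)"
  have [measurable]: "W \<in> borel_measurable borel"
    unfolding W_def by (rule superharmonic_weight_measurable[OF w])
  have [measurable]: "cis \<in> borel_measurable borel"
    by (intro borel_measurable_continuous_onI continuous_intros)
  have "(\<integral>\<^sup>+z\<in>unit_disk. \<omega> z * ((\<integral>\<^sup>+t\<in>{0..2*pi}. u (z - of_real r * cis t) \<partial>lborel) / ennreal (2*pi)) \<partial>lborel)
     = (\<integral>\<^sup>+z. (\<integral>\<^sup>+t. W z * (u (z - of_real r * cis t) * indicator {0..2*pi} t) \<partial>lborel) / ennreal (2*pi) \<partial>lborel)"
    by (simp add: nn_integral_cmult W_def ennreal_times_divide ac_simps)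
  also have "\<dots> = (\<integral>\<^sup>+z. (\<integral>\<^sup>+t. W z * (u (z - of_real r * cis t) * indicator {0..2*pi} t) \<partial>lborel) \<partial>lborel) / ennreal (2*pi)"
    by (rule nn_integral_divide) measurable
  also have "(\<integral>\<^sup>+z. (\<integral>\<^sup>+t. W z * (u (z - of_real r * cis t) * indicator {0..2*pi} t) \<partial>lborel) \<partial>lborel)
     = (\<integral>\<^sup>+t. (\<integral>\<^sup>+z. W z * (u (z - of_real r * cis t) * indicator {0..2*pi} t) \<partial>lborel) \<partial>lborel)"
    by (rule lborel_pair.Fubini') measurable
  also have "\<dots> = (\<integral>\<^sup>+t. (\<integral>\<^sup>+z. W (of_real r * cis t + z) * (u z * indicator {0..2*pi} t) \<partial>lborel) \<partial>lborel)"
  proof (rule nn_integral_cong)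
    fix t :: real
    show "(\<integral>\<^sup>+z. W z * (u (z - of_real r * cis t) * indicator {0..2*pi} t) \<partial>lborel)
      = (\<integral>\<^sup>+z. W (of_real r * cis t + z) * (u z * indicator {0..2*pi} t) \<partial>lborel)"
      using nn_integral_lborel_translate[of "\<lambda>z. W z * (u (z - of_real r * cis t) * indicator {0..2*pi} t)" "of_real r * cis t"]
      by simp
  qed
  also have "\<dots> = (\<integral>\<^sup>+z. (\<integral>\<^sup>+t. W (of_real r * cis t + z) * (u z * indicator {0..2*pi} t) \<partial>lborel) \<partial>lborel)"
    by (rule lborel_pair.Fubini') measurable
  also have "\<dots> / ennreal (2*pi) = (\<integral>\<^sup>+z. (\<integral>\<^sup>+t. W (of_real r * cis t + z) * (u z * indicator {0..2*pi} t) \<partial>lborel) / ennreal (2*pi) \<partial>lborel)"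
    by (rule nn_integral_divide[symmetric]) measurable
  also have "\<dots> \<le> (\<integral>\<^sup>+z\<in>ball 0 \<rho>. \<omega> z * u z \<partial>lborel)"
  proof (rule nn_integral_mono)
    fix z :: complex
    have eq: "(\<integral>\<^sup>+t. W (of_real r * cis t + z) * (u z * indicator {0..2*pi} t) \<partial>lborel)
        = u z * (\<integral>\<^sup>+t\<in>{0..2*pi}. W (z + of_real r * cis t) \<partial>lborel)"
      by (subst nn_integral_cmult[symmetric]) (auto simp: ac_simps)
    show "(\<integral>\<^sup>+t. W (of_real r * cis t + z) * (u z * indicator {0..2*pi} t) \<partial>lborel) / ennreal (2*pi)
      \<le> \<omega> z * u z * indicator (ball 0 \<rho>) z"
    proof (cases "z \<in> ball 0 \<rho>")
      case True
      have "cball z r \<subseteq> unit_disk"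
      proof
        fix y assume "y \<in> cball z r"
        then have "cmod y \<le> cmod z + r" using norm_triangle_sub[of y z] by (auto simp: dist_norm norm_minus_commute)
        then show "y \<in> unit_disk" using True r by simp
      qed
      then have le: "(\<integral>\<^sup>+t\<in>{0..2*pi}. W (z + of_real r * cis t) \<partial>lborel) / ennreal (2*pi) \<le> \<omega> z"
        using superharmonic_weight_mean[OF w r(1), of z] by (simp add: W_def)
      then show ?thesis
        using True mult_left_mono[OF le, of "u z"] unfolding eq by (simp add: ennreal_times_divide mult.commute)
    qed (simp add: supp)
  qed
  finally show ?thesis .
qed

lemma holomorphic_bounded_on_cball:
  assumes "f holomorphic_on ball 0 1" "\<rho> < 1"
  shows "\<exists>M\<ge>0. \<forall>z\<in>cball 0 \<rho>. cmod (f z) \<le> M"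
proof -
  have "continuous_on (cball 0 \<rho>) f"
    using assms by (intro continuous_on_subset[OF holomorphic_on_imp_continuous_on[OF assms(1)]]) auto
  then have "bounded (f ` cball 0 \<rho>)"
    by (intro compact_imp_bounded compact_continuous_image) auto
  then obtain M where "\<forall>z\<in>cball 0 \<rho>. cmod (f z) \<le> M" by (auto simp: bounded_iff)
  then show ?thesis by (intro exI[of _ "max 0 M"]) auto
qed

text \<open>The integrand of the difference of the two sides is a quarter of the Laplacian of
  \<open>(\<rho>\<^sup>2 - |z|\<^sup>2)\<^sup>2 |f|\<^sup>2\<close>, a nonnegative function vanishing to second order on the circle of radius \<open>\<rho>\<close>.
  Cut off outside that circle, it is tested against the super-mean-value inequality on circles of
  radius \<open>r\<close>; the strip of width \<open>r\<close> contributes only \<open>O(r\<^sup>2)\<close> times its \<open>\<omega>\<close>-mass.\<close>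

lemma superharmonic_concavity_ball:
  assumes w: "superharmonic_weight \<omega>" and f: "f holomorphic_on ball 0 1" and \<rho>: "0 < \<rho>" "\<rho> < 1"
  defines "I \<equiv> \<lambda>g. (\<integral>\<^sup>+z\<in>ball 0 \<rho>. ennreal ((cmod (deriv g z))\<^sup>2) * \<omega> z \<partial>lborel)"
  shows "I (\<lambda>z. z\<^sup>2 * f z) + ennreal (\<rho> ^ 4) * I f \<le> ennreal (2 * \<rho>\<^sup>2) * I (\<lambda>z. z * f z)"
proof -
  define f1 where "f1 = (\<lambda>z. z * f z)"
  define f2 where "f2 = (\<lambda>z. z\<^sup>2 * f z)"
  have f1: "f1 holomorphic_on ball 0 1" and f2: "f2 holomorphic_on ball 0 1"
    unfolding f1_def f2_def by (intro holomorphic_intros f)+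
  have cont: "continuous_on (ball 0 1) g" "continuous_on (ball 0 1) (deriv g)" if "g holomorphic_on ball 0 1" for g
    using that by (auto intro!: holomorphic_on_imp_continuous_on holomorphic_deriv)
  define W where "W = (\<lambda>z. \<omega> z * indicator (ball 0 \<rho>) z)"
  have [measurable]: "ball 0 \<rho> \<in> sets (borel :: complex measure)" by simp
  have Wm[measurable]: "W \<in> borel_measurable borel"
  proof -
    have "W = (\<lambda>z. (\<omega> z * indicator unit_disk z) * indicator (ball 0 \<rho>) z)"
      using \<rho> by (auto simp: W_def indicator_def)
    then show ?thesis using superharmonic_weight_measurable[OF w] by simp
  qed
  have Wl: "W \<in> borel_measurable lborel" using Wm by simp
  \<comment> \<open>With the weight inside the measure, \<open>\<mu>\<close> is finite: bounded
    Borel functions, including the sign-changing \<open>L\<close>, become integrable, and constants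
    serve as dominating functions.\<close>
  define \<mu> where "\<mu> = density lborel W"
  have sets[measurable_cong, simp]: "sets \<mu> = sets borel" by (simp add: \<mu>_def)
  have sp[simp]: "space \<mu> = UNIV" by (simp add: \<mu>_def)
  have fin: "emeasure \<mu> UNIV < \<infinity>"
    using superharmonic_weight_locally_integrable[OF w \<rho>(2)]
    unfolding \<mu>_def by (subst emeasure_density[OF _]) (use Wm in \<open>auto simp: W_def\<close>)
  interpret finite_measure \<mu> by (rule finite_measureI) (use fin in \<open>simp add: less_top\<close>)
  have AEb: "AE z in \<mu>. z \<in> ball 0 \<rho>"
    unfolding \<mu>_def AE_density[OF Wl] by (rule AE_I2) (simp add: W_def indicator_def)
  have nn\<mu>: "(\<integral>\<^sup>+z. ennreal (g z) \<partial>\<mu>) = (\<integral>\<^sup>+z\<in>ball 0 \<rho>. ennreal (g z) * \<omega> z \<partial>lborel)"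
    if "g \<in> borel_measurable borel" for g :: "complex \<Rightarrow> real"
    unfolding \<mu>_def using that Wl
    by (subst nn_integral_density) (simp_all add: W_def ac_simps)
  define ind where "ind = (indicator (ball 0 \<rho>) :: complex \<Rightarrow> real)"
  have indm[measurable]: "(\<lambda>z. ind z * g z) \<in> borel_measurable borel" if "continuous_on (ball 0 1) g" for g :: "complex \<Rightarrow> real"
  proof -
    have "continuous_on (ball 0 \<rho>) g" using that \<rho> by (auto intro: continuous_on_subset)
    then show ?thesis
      using borel_measurable_continuous_on_indicator[of "ball 0 \<rho>" g] by (simp add: ind_def)
  qed
  obtain M0 M1 M2 M where M: "M0 \<ge> 0" "M1 \<ge> 0" "M2 \<ge> 0" "M \<ge> 0" 
     "\<And>z. z \<in> cball 0 \<rho> \<Longrightarrow> cmod (deriv f z) \<le> M0"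
     "\<And>z. z \<in> cball 0 \<rho> \<Longrightarrow> cmod (deriv f1 z) \<le> M1"
     "\<And>z. z \<in> cball 0 \<rho> \<Longrightarrow> cmod (deriv f2 z) \<le> M2"
     "\<And>z. z \<in> cball 0 \<rho> \<Longrightarrow> cmod (f z) \<le> M"
    using holomorphic_bounded_on_cball[OF holomorphic_deriv[OF f] \<rho>(2)] holomorphic_bounded_on_cball[OF holomorphic_deriv[OF f1] \<rho>(2)]
      holomorphic_bounded_on_cball[OF holomorphic_deriv[OF f2] \<rho>(2)] holomorphic_bounded_on_cball[OF f \<rho>(2)]
    by auto
  \<comment> \<open>Expanding (\<rho>^2 - |z|^2)^2 makes \<open>v\<close> a combination of squared
    moduli of holomorphic functions. The expansion lemma then applies to each of them, and
    \<open>L\<close> has the same coefficients.\<close>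
  define v where "v = (\<lambda>z. (cmod (f2 z))\<^sup>2 - 2 * \<rho>\<^sup>2 * (cmod (f1 z))\<^sup>2 + \<rho> ^ 4 * (cmod (f z))\<^sup>2)"
  define L where "L = (\<lambda>z. (cmod (deriv f2 z))\<^sup>2 - 2 * \<rho>\<^sup>2 * (cmod (deriv f1 z))\<^sup>2 + \<rho> ^ 4 * (cmod (deriv f z))\<^sup>2)"
  have v_eq: "v z = (\<rho>\<^sup>2 - (cmod z)\<^sup>2)\<^sup>2 * (cmod (f z))\<^sup>2" for z
    unfolding v_def f1_def f2_def norm_mult norm_power
    by (simp add: power2_eq_square power4_eq_xxxx algebra_simps)
  have v0: "v z \<ge> 0" for z unfolding v_eq by simp
  have contv: "continuous_on (ball 0 1) v" and contL: "continuous_on (ball 0 1) L"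
    unfolding v_def L_def by (intro continuous_intros cont f f1 f2)+
  define u where "u = (\<lambda>z. ind z * v z)"
  have um[measurable]: "u \<in> borel_measurable borel" unfolding u_def by (rule indm[OF contv])
  have Lm[measurable]: "(\<lambda>z. ind z * L z) \<in> borel_measurable borel" by (rule indm[OF contL])
  have u0: "u z \<ge> 0" for z using v0 by (simp add: u_def ind_def)
  have ind_sq: "ind z * (cmod (deriv g z))\<^sup>2 \<le> m\<^sup>2" if "\<And>z. z \<in> cball 0 \<rho> \<Longrightarrow> cmod (deriv g z) \<le> m" for g m z
    using that[of z] by (auto simp: ind_def indicator_def intro!: power_mono)
  obtain C0 C1 C2 where C: "C0 \<ge> 0" "C1 \<ge> 0" "C2 \<ge> 0" and
    C0: "\<And>z r. cmod z \<le> \<rho> \<longrightarrow> (\<exists>\<alpha> \<beta>. \<forall>\<zeta>. cmod \<zeta> = r \<longrightarrow> cmod (z - \<zeta>) \<le> \<rho> \<longrightarrow>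
      \<bar>(cmod (f (z - \<zeta>)))\<^sup>2 - (cmod (f z))\<^sup>2 - r\<^sup>2 * (cmod (deriv f z))\<^sup>2 - Re (\<alpha> * \<zeta> + \<beta> * \<zeta>\<^sup>2)\<bar> \<le> C0 * r ^ 3)" and
    C1: "\<And>z r. cmod z \<le> \<rho> \<longrightarrow> (\<exists>\<alpha> \<beta>. \<forall>\<zeta>. cmod \<zeta> = r \<longrightarrow> cmod (z - \<zeta>) \<le> \<rho> \<longrightarrow>
      \<bar>(cmod (f1 (z - \<zeta>)))\<^sup>2 - (cmod (f1 z))\<^sup>2 - r\<^sup>2 * (cmod (deriv f1 z))\<^sup>2 - Re (\<alpha> * \<zeta> + \<beta> * \<zeta>\<^sup>2)\<bar> \<le> C1 * r ^ 3)" and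
    C2: "\<And>z r. cmod z \<le> \<rho> \<longrightarrow> (\<exists>\<alpha> \<beta>. \<forall>\<zeta>. cmod \<zeta> = r \<longrightarrow> cmod (z - \<zeta>) \<le> \<rho> \<longrightarrow>
      \<bar>(cmod (f2 (z - \<zeta>)))\<^sup>2 - (cmod (f2 z))\<^sup>2 - r\<^sup>2 * (cmod (deriv f2 z))\<^sup>2 - Re (\<alpha> * \<zeta> + \<beta> * \<zeta>\<^sup>2)\<bar> \<le> C2 * r ^ 3)"
    using holomorphic_cmod_square_expansion[OF f \<rho>(2)] holomorphic_cmod_square_expansion[OF f1 \<rho>(2)] 
      holomorphic_cmod_square_expansion[OF f2 \<rho>(2)] by blast
  define C where "C = C2 + 2 * \<rho>\<^sup>2 * C1 + \<rho> ^ 4 * C0"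
  define K where "K = 4 * M\<^sup>2"
  have mean: "ennreal (v z + r\<^sup>2 * (L z - C * r)) \<le> (\<integral>\<^sup>+t\<in>{0..2*pi}. ennreal (u (z - of_real r * cis t)) \<partial>lborel) / ennreal (2*pi)"
    if r: "0 < r" and z: "cmod z + r < \<rho>" for z r
  proof -
    have z\<rho>: "cmod z \<le> \<rho>" using r z by simp
    have in\<rho>: "cmod (z - of_real r * cis t) < \<rho>" for t
      using norm_triangle_ineq4[of z "of_real r * cis t"] r z by (simp add: norm_mult)
    obtain a0 b0 where 0: "\<And>\<zeta>. cmod \<zeta> = r \<Longrightarrow> cmod (z - \<zeta>) \<le> \<rho> \<Longrightarrow>
      \<bar>(cmod (f (z - \<zeta>)))\<^sup>2 - (cmod (f z))\<^sup>2 - r\<^sup>2 * (cmod (deriv f z))\<^sup>2 - Re (a0 * \<zeta> + b0 * \<zeta>\<^sup>2)\<bar> \<le> C0 * r ^ 3"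
      using C0[of z r] z\<rho> by blast
    obtain a1 b1 where 1: "\<And>\<zeta>. cmod \<zeta> = r \<Longrightarrow> cmod (z - \<zeta>) \<le> \<rho> \<Longrightarrow>
      \<bar>(cmod (f1 (z - \<zeta>)))\<^sup>2 - (cmod (f1 z))\<^sup>2 - r\<^sup>2 * (cmod (deriv f1 z))\<^sup>2 - Re (a1 * \<zeta> + b1 * \<zeta>\<^sup>2)\<bar> \<le> C1 * r ^ 3"
      using C1[of z r] z\<rho> by blast
    obtain a2 b2 where 2: "\<And>\<zeta>. cmod \<zeta> = r \<Longrightarrow> cmod (z - \<zeta>) \<le> \<rho> \<Longrightarrow>
      \<bar>(cmod (f2 (z - \<zeta>)))\<^sup>2 - (cmod (f2 z))\<^sup>2 - r\<^sup>2 * (cmod (deriv f2 z))\<^sup>2 - Re (a2 * \<zeta> + b2 * \<zeta>\<^sup>2)\<bar> \<le> C2 * r ^ 3"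
      using C2[of z r] z\<rho> by blast
    define a where "a = a2 - of_real (2 * \<rho>\<^sup>2) * a1 + of_real (\<rho> ^ 4) * a0"
    define b where "b = b2 - of_real (2 * \<rho>\<^sup>2) * b1 + of_real (\<rho> ^ 4) * b0"
    have low: "v z + r\<^sup>2 * (L z - C * r) + Re ((a * of_real r) * cis t + (b * of_real (r\<^sup>2)) * (cis t)\<^sup>2) \<le> u (z - of_real r * cis t)" for t
    proof -
      define \<zeta> where "\<zeta> = of_real r * cis t"
      have \<zeta>: "cmod \<zeta> = r" "cmod (z - \<zeta>) \<le> \<rho>" using r in\<rho>[of t] by (auto simp: \<zeta>_def norm_mult)
      have Re_scale: "Re (of_real c * A) = c * Re A" for c A by simp
      define A0 where "A0 = a0 * \<zeta> + b0 * \<zeta>\<^sup>2"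
      define A1 where "A1 = a1 * \<zeta> + b1 * \<zeta>\<^sup>2"
      define A2 where "A2 = a2 * \<zeta> + b2 * \<zeta>\<^sup>2"
      have "(a * of_real r) * cis t + (b * of_real (r\<^sup>2)) * (cis t)\<^sup>2 = A2 - of_real (2 * \<rho>\<^sup>2) * A1 + of_real (\<rho> ^ 4) * A0"
        by (simp add: A0_def A1_def A2_def a_def b_def \<zeta>_def power_mult_distrib algebra_simps)
      then have "Re ((a * of_real r) * cis t + (b * of_real (r\<^sup>2)) * (cis t)\<^sup>2) = Re A2 - (2 * \<rho>\<^sup>2) * Re A1 + \<rho> ^ 4 * Re A0"
        by (simp only: plus_complex.sel minus_complex.sel Re_scale)
      moreover have "(cmod (f2 (z - \<zeta>)))\<^sup>2 \<ge> (cmod (f2 z))\<^sup>2 + r\<^sup>2 * (cmod (deriv f2 z))\<^sup>2 + Re A2 - C2 * r ^ 3"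
        using 2[OF \<zeta>] by (simp add: A2_def)
      \<comment> \<open>\<open>f1\<close> enters \<open>v\<close> with a negative coefficient, so
        here the upper half of the expansion is used.\<close>
      moreover have "(2 * \<rho>\<^sup>2) * (cmod (f1 (z - \<zeta>)))\<^sup>2 \<le> (2 * \<rho>\<^sup>2) * ((cmod (f1 z))\<^sup>2 + r\<^sup>2 * (cmod (deriv f1 z))\<^sup>2 + Re A1 + C1 * r ^ 3)"
        using 1[OF \<zeta>] by (intro mult_left_mono) (auto simp: A1_def)
      moreover have "\<rho> ^ 4 * (cmod (f (z - \<zeta>)))\<^sup>2 \<ge> \<rho> ^ 4 * ((cmod (f z))\<^sup>2 + r\<^sup>2 * (cmod (deriv f z))\<^sup>2 + Re A0 - C0 * r ^ 3)"
        using 0[OF \<zeta>] by (intro mult_left_mono) (auto simp: A0_def)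
      moreover have "u (z - \<zeta>) = v (z - \<zeta>)"
        using in\<rho>[of t] by (simp add: u_def ind_def \<zeta>_def)
      moreover have "r\<^sup>2 * (L z - C * r) = r\<^sup>2 * (cmod (deriv f2 z))\<^sup>2 - (2 * \<rho>\<^sup>2) * (r\<^sup>2 * (cmod (deriv f1 z))\<^sup>2) 
          + \<rho> ^ 4 * (r\<^sup>2 * (cmod (deriv f z))\<^sup>2) - C2 * r ^ 3 - (2 * \<rho>\<^sup>2) * (C1 * r ^ 3) - \<rho> ^ 4 * (C0 * r ^ 3)"
        by (simp add: L_def C_def power3_eq_cube power2_eq_square algebra_simps)
      ultimately show ?thesis
        unfolding v_def \<zeta>_def[symmetric] by (simp only: ring_distribs mult.assoc)
    qed
    show ?thesis
    proof (rule circle_mean_lower_bound[OF _ _ low])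
      have "continuous_on {0..2*pi} (\<lambda>t. v (z - of_real r * cis t))"
        by (intro continuous_on_compose2[OF contv] continuous_intros) (use less_trans[OF in\<rho> \<rho>(2)] in auto)
      then show "continuous_on {0..2*pi} (\<lambda>t. u (z - of_real r * cis t))"
        using in\<rho> by (simp add: u_def ind_def)
    qed (rule u0)
  qed
  have v_strip: "v z \<le> K * r\<^sup>2" if "cmod z < \<rho>" "\<rho> \<le> cmod z + r" for z r
  proof -
    have "\<rho>\<^sup>2 - (cmod z)\<^sup>2 = (\<rho> - cmod z) * (\<rho> + cmod z)"
      by (simp add: power2_eq_square algebra_simps)
    also have "\<dots> \<le> r * 2" using that \<rho> by (intro mult_mono) auto
    finally have "\<rho>\<^sup>2 - (cmod z)\<^sup>2 \<le> 2 * r" by simp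
    moreover have "0 \<le> \<rho>\<^sup>2 - (cmod z)\<^sup>2" using that(1) by (simp add: power_mono)
    ultimately have "(\<rho>\<^sup>2 - (cmod z)\<^sup>2)\<^sup>2 \<le> (2 * r)\<^sup>2" by (rule power_mono)
    moreover have "(cmod (f z))\<^sup>2 \<le> M\<^sup>2" using M(8)[of z] that(1) by (intro power_mono) auto
    ultimately have "v z \<le> (2 * r)\<^sup>2 * M\<^sup>2"
      unfolding v_eq by (intro mult_mono) auto
    then show ?thesis by (simp add: K_def power_mult_distrib ac_simps)
  qed
  \<comment> \<open>A lower bound for (circle mean of u - u) / r^2. On the strip u \<le> K r^2, so
    the value -K makes u + r^2 \<psi> nonpositive there, and nonnegativity of the mean
    suffices.\<close>
  define \<psi> where "\<psi> = (\<lambda>r z. if cmod z + r < \<rho> then ind z * L z - C * r else - K)"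
  have \<psi>m[measurable]: "\<psi> r \<in> borel_measurable borel" for r unfolding \<psi>_def by measurable
  have K0: "K \<ge> 0" by (simp add: K_def)
  have C0': "C \<ge> 0" using C by (simp add: C_def)
  define B where "B = M2\<^sup>2 + 2 * \<rho>\<^sup>2 * M1\<^sup>2 + \<rho> ^ 4 * M0\<^sup>2"
  have indL: "\<bar>ind z * L z\<bar> \<le> B" for z
  proof -
    have "\<bar>ind z * L z\<bar> = \<bar>ind z * (cmod (deriv f2 z))\<^sup>2 - 2 * \<rho>\<^sup>2 * (ind z * (cmod (deriv f1 z))\<^sup>2) + \<rho> ^ 4 * (ind z * (cmod (deriv f z))\<^sup>2)\<bar>"
      by (simp add: L_def algebra_simps)
    also have "\<dots> \<le> ind z * (cmod (deriv f2 z))\<^sup>2 + 2 * \<rho>\<^sup>2 * (ind z * (cmod (deriv f1 z))\<^sup>2) + \<rho> ^ 4 * (ind z * (cmod (deriv f z))\<^sup>2)"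
      by (intro order_trans[OF abs_triangle_ineq] add_mono order_trans[OF abs_triangle_ineq4]) (auto simp: ind_def)
    also have "\<dots> \<le> B"
      unfolding B_def by (intro add_mono mult_left_mono ind_sq M) auto
    finally show ?thesis .
  qed
  have \<psi>b: "\<bar>\<psi> r z\<bar> \<le> B + C + K" if "0 < r" "r < 1" for r z
  proof -
    have "B \<ge> 0" using indL[of 0] by linarith
    moreover have "0 \<le> C * r" "C * r \<le> C" using that C0' by (auto simp: mult_left_le)
    ultimately show ?thesis using indL[of z] K0 by (auto simp: \<psi>_def abs_le_iff)
  qed
  have int_ub: "integrable \<mu> g" if "g \<in> borel_measurable borel" "\<And>z. \<bar>g z\<bar> \<le> b" for g :: "complex \<Rightarrow> real" and b
    using that by (intro integrable_const_bound[of _ b]) auto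
  have u_b: "\<bar>u z\<bar> \<le> K" for z
    using v_strip[of z \<rho>] v0[of z] \<rho> K0 mult_left_le[of "\<rho>\<^sup>2" K]
    by (auto simp: u_def ind_def indicator_def abs_le_iff power_le_one)
  have \<psi>_le: "(\<integral>z. \<psi> r z \<partial>\<mu>) \<le> 0" if r: "0 < r" "r < 1 - \<rho>" for r
  proof -
    have r1: "r < 1" using r \<rho> by simp
    \<comment> \<open>The comparison of integrals takes place in \<open>ennreal\<close>; truncating
      at 0 stays below the nonnegative circle mean and above u + r^2 \<psi>.\<close>
    define a where "a = (\<lambda>z. max 0 (u z + r\<^sup>2 * \<psi> r z))"
    have am[measurable]: "a \<in> borel_measurable borel" unfolding a_def by measurable
    have a_le: "ennreal (a z) \<le> (\<integral>\<^sup>+t\<in>{0..2*pi}. ennreal (u (z - of_real r * cis t)) \<partial>lborel) / ennreal (2*pi)"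
      if z: "z \<in> ball 0 \<rho>" for z
    proof (cases "cmod z + r < \<rho>")
      case True
      have "ennreal (a z) = ennreal (u z + r\<^sup>2 * \<psi> r z)"
        by (simp add: a_def max_def ennreal_neg)
      also have "u z + r\<^sup>2 * \<psi> r z = v z + r\<^sup>2 * (L z - C * r)"
        using True z by (simp add: u_def ind_def \<psi>_def)
      finally show ?thesis using mean[OF r(1) True] by simp
    next
      case False
      then have "a z = 0"
        using v_strip[of z r] z by (auto simp: a_def \<psi>_def u_def ind_def max_def algebra_simps)
      then show ?thesis by simp
    qed
    have "(\<integral>\<^sup>+z. ennreal (a z) \<partial>\<mu>) = (\<integral>\<^sup>+z\<in>ball 0 \<rho>. ennreal (a z) * \<omega> z \<partial>lborel)" by (rule nn\<mu>) measurable
    also have "\<dots> \<le> (\<integral>\<^sup>+z\<in>unit_disk. \<omega> z * ((\<integral>\<^sup>+t\<in>{0..2*pi}. ennreal (u (z - of_real r * cis t)) \<partial>lborel) / ennreal (2*pi)) \<partial>lborel)"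
      using a_le \<rho> by (intro nn_integral_mono) (auto simp: indicator_def mult.commute[of _ "\<omega> _"] intro!: mult_left_mono)
    also have "\<dots> \<le> (\<integral>\<^sup>+z\<in>ball 0 \<rho>. \<omega> z * ennreal (u z) \<partial>lborel)"
    proof (rule superharmonic_convolution_le[OF w r(1)])
      show "(\<lambda>z. ennreal (u z)) \<in> borel_measurable borel" by measurable
    qed (use r in \<open>auto simp: u_def ind_def\<close>)
    also have "\<dots> = (\<integral>\<^sup>+z. ennreal (u z) \<partial>\<mu>)"
      by (subst nn\<mu>) (auto simp: mult.commute)
    finally have le: "(\<integral>\<^sup>+z. ennreal (a z) \<partial>\<mu>) \<le> (\<integral>\<^sup>+z. ennreal (u z) \<partial>\<mu>)" .
    have iu: "integrable \<mu> u" by (rule int_ub[OF um u_b])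
    have i\<psi>: "integrable \<mu> (\<psi> r)" by (rule int_ub[OF \<psi>m \<psi>b[OF r(1) r1]])
    have ia: "integrable \<mu> a" unfolding a_def using iu i\<psi> by (intro integrable_max integrable_add integrable_mult_right) auto
    have "(\<integral>z. a z \<partial>\<mu>) \<le> (\<integral>z. u z \<partial>\<mu>)"
      using le ia iu u0 by (simp add: nn_integral_eq_integral a_def integral_nonneg_AE)
    moreover have "(\<integral>z. u z + r\<^sup>2 * \<psi> r z \<partial>\<mu>) \<le> (\<integral>z. a z \<partial>\<mu>)"
      using ia iu i\<psi> by (intro integral_mono) (auto simp: a_def)
    ultimately have "r\<^sup>2 * (\<integral>z. \<psi> r z \<partial>\<mu>) \<le> 0"
      using iu i\<psi> by simp
    then show ?thesis using r(1) by (simp add: mult_le_0_iff)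
  qed
  \<comment> \<open>A null sequence of radii; the summand 2 keeps it strictly below 1 - \<rho>
    already at n = 0.\<close>
  define s where "s = (\<lambda>n. (1 - \<rho>) / (real n + 2))"
  have s: "0 < s n" "s n < 1 - \<rho>" "s n < 1" for n
  proof -
    show "0 < s n" using \<rho> by (simp add: s_def)
    have "(1 - \<rho>) / (real n + 2) < (1 - \<rho>) / 1" using \<rho> by (intro divide_strict_left_mono) auto
    then show "s n < 1 - \<rho>" by (simp add: s_def)
    then show "s n < 1" using \<rho> by simp
  qed
  have s0: "s \<longlonglongrightarrow> 0"
    using LIMSEQ_ignore_initial_segment[OF lim_const_over_n[of "1 - \<rho>"], of 2]
    by (simp add: s_def add.commute)
  have "(\<lambda>n. \<integral>z. \<psi> (s n) z \<partial>\<mu>) \<longlonglongrightarrow> (\<integral>z. ind z * L z \<partial>\<mu>)"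
  proof (rule integral_dominated_convergence[where w = "\<lambda>_. B + C + K"])
    show "AE z in \<mu>. (\<lambda>n. \<psi> (s n) z) \<longlonglongrightarrow> ind z * L z"
      using AEb
    proof eventually_elim
      fix z :: complex assume "z \<in> ball 0 \<rho>"
      then have "\<rho> - cmod z > 0" by simp
      then have "\<forall>\<^sub>F n in sequentially. s n < \<rho> - cmod z" using s0 by (rule order_tendstoD(2)[rotated])
      then have ev: "\<forall>\<^sub>F n in sequentially. ind z * L z - C * s n = \<psi> (s n) z"
        by eventually_elim (simp add: \<psi>_def)
      have "(\<lambda>n. ind z * L z - C * s n) \<longlonglongrightarrow> ind z * L z - C * 0" by (intro tendsto_intros s0)
      then have "(\<lambda>n. ind z * L z - C * s n) \<longlonglongrightarrow> ind z * L z" by simp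
      then show "(\<lambda>n. \<psi> (s n) z) \<longlonglongrightarrow> ind z * L z" by (rule Lim_transform_eventually[OF _ ev])
    qed
  qed (use \<psi>b[OF s(1,3)] in auto)
  then have L_le: "(\<integral>z. ind z * L z \<partial>\<mu>) \<le> 0"
    by (rule LIMSEQ_le_const2) (use \<psi>_le[OF s(1,2)] in auto)
  have I_eq: "I g = ennreal (\<integral>z. ind z * (cmod (deriv g z))\<^sup>2 \<partial>\<mu>)" and
       int: "integrable \<mu> (\<lambda>z. ind z * (cmod (deriv g z))\<^sup>2)"
    if g: "g holomorphic_on ball 0 1" and m: "\<And>z. z \<in> cball 0 \<rho> \<Longrightarrow> cmod (deriv g z) \<le> m" for g m
  proof -
    have meas: "(\<lambda>z. ind z * (cmod (deriv g z))\<^sup>2) \<in> borel_measurable borel"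
      by (rule indm) (intro continuous_intros cont g)
    show int: "integrable \<mu> (\<lambda>z. ind z * (cmod (deriv g z))\<^sup>2)"
      by (rule int_ub[OF meas, of "m\<^sup>2"]) (use ind_sq[OF m] in \<open>auto simp: ind_def\<close>)
    have "I g = (\<integral>\<^sup>+z\<in>ball 0 \<rho>. ennreal (ind z * (cmod (deriv g z))\<^sup>2) * \<omega> z \<partial>lborel)"
      unfolding I_def by (intro nn_integral_cong) (auto simp: ind_def indicator_def)
    also have "\<dots> = (\<integral>\<^sup>+z. ennreal (ind z * (cmod (deriv g z))\<^sup>2) \<partial>\<mu>)" by (rule nn\<mu>[symmetric, OF meas])
    also have "\<dots> = ennreal (\<integral>z. ind z * (cmod (deriv g z))\<^sup>2 \<partial>\<mu>)"
      by (rule nn_integral_eq_integral[OF int]) (auto simp: ind_def)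
    finally show "I g = \<dots>" .
  qed
  define X where "X = (\<lambda>g. \<integral>z. ind z * (cmod (deriv g z))\<^sup>2 \<partial>\<mu>)"
  have pos: "0 \<le> X g" for g
    unfolding X_def by (rule integral_nonneg_AE) (auto simp: ind_def)
  have I0: "I f = ennreal (X f)" and I1: "I f1 = ennreal (X f1)" and I2: "I f2 = ennreal (X f2)"
    unfolding X_def by (rule I_eq[OF f M(5)] I_eq[OF f1 M(6)] I_eq[OF f2 M(7)]; assumption)+
  note ints = int[OF f M(5)] int[OF f1 M(6)] int[OF f2 M(7)]
  have "(\<integral>z. ind z * L z \<partial>\<mu>) = (\<integral>z. ind z * (cmod (deriv f2 z))\<^sup>2 - 2 * \<rho>\<^sup>2 * (ind z * (cmod (deriv f1 z))\<^sup>2) + \<rho> ^ 4 * (ind z * (cmod (deriv f z))\<^sup>2) \<partial>\<mu>)"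
    by (intro Bochner_Integration.integral_cong) (auto simp: L_def algebra_simps)
  also have "\<dots> = X f2 - 2 * \<rho>\<^sup>2 * X f1 + \<rho> ^ 4 * X f"
    using ints by (simp add: X_def)
  finally have le: "X f2 + \<rho> ^ 4 * X f \<le> 2 * \<rho>\<^sup>2 * X f1" using L_le by linarith
  have "I f2 + ennreal (\<rho> ^ 4) * I f = ennreal (X f2 + \<rho> ^ 4 * X f)"
    using \<rho>(1) pos I0 I2 by (simp add: ennreal_mult)
  also have "\<dots> \<le> ennreal (2 * \<rho>\<^sup>2 * X f1)" by (rule ennreal_leI[OF le])
  also have "\<dots> = ennreal (2 * \<rho>\<^sup>2) * I f1"
    unfolding I1 using pos by (intro ennreal_mult) auto
  finally have "I f2 + ennreal (\<rho> ^ 4) * I f \<le> ennreal (2 * \<rho>\<^sup>2) * I f1" .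
  then show ?thesis by (simp add: f1_def f2_def)
qed

section \<open>The energy as a quadratic form\<close>

definition energy :: "(complex \<Rightarrow> ennreal) \<Rightarrow> (complex \<Rightarrow> complex) \<Rightarrow> ennreal" where
  "energy \<omega> f = (\<integral>\<^sup>+z\<in>unit_disk. ennreal ((cmod (deriv f z))\<^sup>2) * \<omega> z \<partial>lborel)"

lemma dirichlet_integral_energy: "dirichlet_integral \<omega> f = energy \<omega> f / ennreal pi"
  by (simp add: dirichlet_integral_def energy_def)

lemma deriv_cong_unit_disk:
  assumes "\<And>z. z \<in> unit_disk \<Longrightarrow> f z = g z" "z \<in> unit_disk"
  shows "deriv f z = deriv g z"
proof (rule deriv_cong_ev)
  show "\<forall>\<^sub>F x in nhds z. f x = g x"
    using assms by (intro eventually_nhds_in_open[of unit_disk z, THEN eventually_mono]) auto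
qed simp

lemma energy_cong:
  assumes "\<And>z. z \<in> unit_disk \<Longrightarrow> f z = g z"
  shows "energy \<omega> f = energy \<omega> g"
  unfolding energy_def using deriv_cong_unit_disk[OF assms]
  by (intro nn_integral_cong) (auto simp: indicator_def)

lemma deriv_lincomb:
  assumes "f holomorphic_on unit_disk" "g holomorphic_on unit_disk" "z \<in> unit_disk"
  shows "deriv (\<lambda>z. a * f z + b * g z) z = a * deriv f z + b * deriv g z"
  using holomorphic_derivI[OF assms(1) _ assms(3)] holomorphic_derivI[OF assms(2) _ assms(3)]
  by (intro DERIV_imp_deriv) (auto intro!: derivative_eq_intros)

lemma energy_add_const:
  assumes "f holomorphic_on unit_disk"
  shows "energy \<omega> (\<lambda>z. c + f z) = energy \<omega> f"
  unfolding energy_def using deriv_lincomb[of "\<lambda>_. 1" f _ c 1] assms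
  by (intro nn_integral_cong) (auto simp: indicator_def)

lemma borel_measurable_deriv_square:
  assumes "f holomorphic_on unit_disk"
  shows "(\<lambda>z. indicator unit_disk z * (cmod (deriv f z))\<^sup>2 :: real) \<in> borel_measurable borel"
proof -
  have "continuous_on unit_disk (\<lambda>z. (cmod (deriv f z))\<^sup>2)"
    using assms by (intro continuous_intros holomorphic_on_imp_continuous_on holomorphic_deriv) auto
  then show ?thesis
    using borel_measurable_continuous_on_indicator[of unit_disk "\<lambda>z. (cmod (deriv f z))\<^sup>2"] by simp
qed

text \<open>Reduces scaling, the parallelogram law and the Fejer identity to pointwise identities
  between squared moduli of derivatives; with coefficient 0 it also serves shorter sums.\<close>

lemma energy_lincomb3:
  assumes w: "superharmonic_weight \<omega>"
    and f: "f holomorphic_on unit_disk" and g: "g holomorphic_on unit_disk" and h: "h holomorphic_on unit_disk"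
    and c: "0 \<le> a" "0 \<le> b" "0 \<le> c"
  shows "ennreal a * energy \<omega> f + ennreal b * energy \<omega> g + ennreal c * energy \<omega> h
    = (\<integral>\<^sup>+z\<in>unit_disk. ennreal (a * (cmod (deriv f z))\<^sup>2 + b * (cmod (deriv g z))\<^sup>2 + c * (cmod (deriv h z))\<^sup>2) * \<omega> z \<partial>lborel)"
proof -
  define W where "W = (\<lambda>z. \<omega> z * indicator unit_disk z)"
  have [measurable]: "W \<in> borel_measurable borel"
    unfolding W_def by (rule superharmonic_weight_measurable[OF w])
  define F where "F = (\<lambda>f z. indicator unit_disk z * (cmod (deriv f z))\<^sup>2 :: real)"
  have [measurable]: "F f \<in> borel_measurable borel" "F g \<in> borel_measurable borel" "F h \<in> borel_measurable borel"
    unfolding F_def using f g h by (auto intro!: borel_measurable_deriv_square)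
  have F0: "F f z \<ge> 0" for f z by (simp add: F_def)
  have E: "energy \<omega> f = (\<integral>\<^sup>+z. ennreal (F f z) * W z \<partial>lborel)" for f
    unfolding energy_def F_def W_def by (intro nn_integral_cong) (auto simp: indicator_def)
  have "ennreal a * energy \<omega> f + ennreal b * energy \<omega> g + ennreal c * energy \<omega> h
    = (\<integral>\<^sup>+z. ennreal a * (ennreal (F f z) * W z) + ennreal b * (ennreal (F g z) * W z) + ennreal c * (ennreal (F h z) * W z) \<partial>lborel)"
    unfolding E by (simp add: nn_integral_add nn_integral_cmult)
  also have "\<dots> = (\<integral>\<^sup>+z. ennreal (a * F f z + b * F g z + c * F h z) * W z \<partial>lborel)"
    using c F0 by (intro nn_integral_cong) (simp add: ennreal_mult distrib_right mult.assoc)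
  also have "\<dots> = (\<integral>\<^sup>+z\<in>unit_disk. ennreal (a * (cmod (deriv f z))\<^sup>2 + b * (cmod (deriv g z))\<^sup>2 + c * (cmod (deriv h z))\<^sup>2) * \<omega> z \<partial>lborel)"
    unfolding F_def W_def by (intro nn_integral_cong) (auto simp: indicator_def)
  finally show ?thesis .
qed

lemma energy_cmult:
  assumes w: "superharmonic_weight \<omega>" and f: "f holomorphic_on unit_disk"
  shows "energy \<omega> (\<lambda>z. c * f z) = ennreal ((cmod c)\<^sup>2) * energy \<omega> f"
proof -
  have "ennreal ((cmod c)\<^sup>2) * energy \<omega> f = (\<integral>\<^sup>+z\<in>unit_disk. ennreal ((cmod c)\<^sup>2 * (cmod (deriv f z))\<^sup>2) * \<omega> z \<partial>lborel)"
    using energy_lincomb3[OF w f f f, of "(cmod c)\<^sup>2" 0 0] by simp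
  also have "\<dots> = energy \<omega> (\<lambda>z. c * f z)"
    unfolding energy_def using deriv_lincomb[OF f f, of _ c 0]
    by (intro nn_integral_cong) (auto simp: indicator_def norm_mult power_mult_distrib)
  finally show ?thesis by simp
qed

lemma energy_parallelogram:
  assumes w: "superharmonic_weight \<omega>" and f: "f holomorphic_on unit_disk" and g: "g holomorphic_on unit_disk"
  shows "energy \<omega> (\<lambda>z. f z - g z) + energy \<omega> (\<lambda>z. f z + g z) = 2 * energy \<omega> f + 2 * energy \<omega> g"
proof -
  have d: "deriv (\<lambda>z. f z - g z) z = deriv f z - deriv g z" "deriv (\<lambda>z. f z + g z) z = deriv f z + deriv g z"
    if "z \<in> unit_disk" for z
    using deriv_lincomb[OF f g that, of 1 "-1"] deriv_lincomb[OF f g that, of 1 1] by simp_all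
  have hol: "(\<lambda>z. f z - g z) holomorphic_on unit_disk" "(\<lambda>z. f z + g z) holomorphic_on unit_disk"
    by (intro holomorphic_intros f g)+
  have par: "(cmod (x - y))\<^sup>2 + (cmod (x + y))\<^sup>2 = 2 * (cmod x)\<^sup>2 + 2 * (cmod y)\<^sup>2" for x y
    by (simp add: cmod_power2) (simp add: power2_eq_square algebra_simps)
  have "energy \<omega> (\<lambda>z. f z - g z) + energy \<omega> (\<lambda>z. f z + g z)
     = (\<integral>\<^sup>+z\<in>unit_disk. ennreal ((cmod (deriv (\<lambda>z. f z - g z) z))\<^sup>2 + (cmod (deriv (\<lambda>z. f z + g z) z))\<^sup>2) * \<omega> z \<partial>lborel)"
    using energy_lincomb3[OF w hol f, of 1 1 0] by simp
  also have "\<dots> = (\<integral>\<^sup>+z\<in>unit_disk. ennreal (2 * (cmod (deriv f z))\<^sup>2 + 2 * (cmod (deriv g z))\<^sup>2) * \<omega> z \<partial>lborel)"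
    by (intro nn_integral_cong) (simp add: indicator_def d par del: ennreal_plus)
  also have "\<dots> = 2 * energy \<omega> f + 2 * energy \<omega> g"
    using energy_lincomb3[OF w f g f, of 2 2 0] by simp
  finally show ?thesis .
qed

lemma energy_diff_le:
  assumes "superharmonic_weight \<omega>" "f holomorphic_on unit_disk" "g holomorphic_on unit_disk"
  shows "energy \<omega> (\<lambda>z. f z - g z) \<le> 2 * energy \<omega> f + 2 * energy \<omega> g"
  unfolding energy_parallelogram[OF assms, symmetric] by simp

lemma energy_lincomb_finite:
  assumes w: "superharmonic_weight \<omega>" and f: "f holomorphic_on unit_disk" "energy \<omega> f < \<infinity>"
    and g: "g holomorphic_on unit_disk" "energy \<omega> g < \<infinity>"
  shows "energy \<omega> (\<lambda>z. a * f z + b * g z) < \<infinity>"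
proof -
  have "energy \<omega> (\<lambda>z. a * f z - (- b) * g z) \<le> 2 * energy \<omega> (\<lambda>z. a * f z) + 2 * energy \<omega> (\<lambda>z. (- b) * g z)"
    by (intro energy_diff_le[OF w] holomorphic_intros f g)
  also have "\<dots> < \<infinity>"
    using f g by (simp only: energy_cmult[OF w f(1)] energy_cmult[OF w g(1)]) (auto simp: ennreal_mult_less_top)
  finally show ?thesis by simp
qed

text \<open>Let \<rho> increase to 1 in the inequality on smaller disks. Monotone convergence allows
  infinite energies, so that finiteness of the right side can later be used to infer finiteness of
  both energies on the left.\<close>

lemma energy_concave:
  assumes w: "superharmonic_weight \<omega>" and f: "f holomorphic_on unit_disk"
  shows "energy \<omega> (\<lambda>z. z\<^sup>2 * f z) + energy \<omega> f \<le> 2 * energy \<omega> (\<lambda>z. z * f z)"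
proof -
  define s where "s = (\<lambda>n. 1 - 1 / (real n + 2))"
  have s: "0 < s n" "s n < 1" for n by (auto simp: s_def field_simps)
  have s1: "s \<longlonglongrightarrow> 1"
    using tendsto_diff[OF tendsto_const[of 1] LIMSEQ_ignore_initial_segment[OF lim_const_over_n[of "1::real"], of 2]]
    by (simp add: s_def add.commute)
  have smono: "s m \<le> s n" if "m \<le> n" for m n using that by (simp add: s_def frac_le)
  define I where "I = (\<lambda>n g. (\<integral>\<^sup>+z\<in>ball 0 (s n). ennreal ((cmod (deriv g z))\<^sup>2) * \<omega> z \<partial>lborel))"
  have I_lim: "(\<lambda>n. I n g) \<longlonglongrightarrow> energy \<omega> g" if g: "g holomorphic_on unit_disk" for g
    unfolding I_def energy_def
  proof (rule nn_integral_LIMSEQ)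
    show "incseq (\<lambda>n z. ennreal ((cmod (deriv g z))\<^sup>2) * \<omega> z * indicator (ball 0 (s n)) z)"
      using smono by (fastforce simp: incseq_def le_fun_def indicator_def)
    fix n
    have "(\<lambda>z. ennreal ((cmod (deriv g z))\<^sup>2) * \<omega> z * indicator (ball 0 (s n)) z)
       = (\<lambda>z. ennreal (indicator unit_disk z * (cmod (deriv g z))\<^sup>2) * (\<omega> z * indicator unit_disk z) * indicator (ball 0 (s n)) z)"
      using s(2)[of n] by (auto simp: indicator_def fun_eq_iff)
    also have "\<dots> \<in> borel_measurable lborel"
      using borel_measurable_deriv_square[OF g] superharmonic_weight_measurable[OF w]
      by (auto intro!: borel_measurable_times_ennreal borel_measurable_indicator)
    finally show "(\<lambda>z. ennreal ((cmod (deriv g z))\<^sup>2) * \<omega> z * indicator (ball 0 (s n)) z) \<in> borel_measurable lborel" .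
  next
    fix z :: complex
    show "(\<lambda>n. ennreal ((cmod (deriv g z))\<^sup>2) * \<omega> z * indicator (ball 0 (s n)) z)
       \<longlonglongrightarrow> ennreal ((cmod (deriv g z))\<^sup>2) * \<omega> z * indicator unit_disk z"
    proof (cases "z \<in> unit_disk")
      case True
      then have "\<forall>\<^sub>F n in sequentially. cmod z < s n" using s1 by (intro order_tendstoD(1)[OF s1]) auto
      then show ?thesis using True by (intro tendsto_eventually) (auto elim!: eventually_mono)
    next
      case False
      then have "z \<notin> ball 0 (s n)" for n using s(2)[of n] by auto
      then show ?thesis using False by simp
    qed
  qed
  have hol: "(\<lambda>z. z * f z) holomorphic_on unit_disk" "(\<lambda>z. z\<^sup>2 * f z) holomorphic_on unit_disk"
    by (intro holomorphic_intros f)+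
  have le: "I n (\<lambda>z. z\<^sup>2 * f z) + ennreal (s n ^ 4) * I n f \<le> ennreal (2 * (s n)\<^sup>2) * I n (\<lambda>z. z * f z)" for n
    unfolding I_def by (rule superharmonic_concavity_ball[OF w f s])
  have s4: "(\<lambda>n. ennreal (s n ^ 4)) \<longlonglongrightarrow> 1" and s2: "(\<lambda>n. ennreal (2 * (s n)\<^sup>2)) \<longlonglongrightarrow> 2"
    using tendsto_ennrealI[OF tendsto_power[OF s1, of 4]]
      tendsto_ennrealI[OF tendsto_mult[OF tendsto_const[of 2] tendsto_power[OF s1, of 2]]] by simp_all
  have "(\<lambda>n. I n (\<lambda>z. z\<^sup>2 * f z) + ennreal (s n ^ 4) * I n f) \<longlonglongrightarrow> energy \<omega> (\<lambda>z. z\<^sup>2 * f z) + 1 * energy \<omega> f"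
    by (intro tendsto_add tendsto_mult_ennreal I_lim hol f s4) auto
  moreover have "(\<lambda>n. ennreal (2 * (s n)\<^sup>2) * I n (\<lambda>z. z * f z)) \<longlonglongrightarrow> 2 * energy \<omega> (\<lambda>z. z * f z)"
    by (intro tendsto_mult_ennreal I_lim hol s2) auto
  ultimately show ?thesis
    using le by (auto intro: LIMSEQ_le)
qed

subsection \<open>The defect of the shift\<close>

text \<open>\<open>enn2real\<close> sends infinity to 0, so the value is meaningful only for finite
  energy. Real values are needed for the subtraction in the defect.\<close>

definition real_energy :: "(complex \<Rightarrow> ennreal) \<Rightarrow> (complex \<Rightarrow> complex) \<Rightarrow> real" where
  "real_energy \<omega> f = enn2real (energy \<omega> f)"

text \<open>The condition on \<open>z f\<close> is the one that Taylor tails inherit; by concavity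
  it implies finite energy of \<open>f\<close> and of every further shift.\<close>

definition shift_domain :: "(complex \<Rightarrow> ennreal) \<Rightarrow> (complex \<Rightarrow> complex) set" where
  "shift_domain \<omega> = {f. f holomorphic_on unit_disk \<and> energy \<omega> (\<lambda>z. z * f z) < \<infinity>}"

text \<open>For the Poisson kernel at a boundary point \<open>\<zeta>\<close> this is a multiple of \<open>|f \<zeta>|\<^sup>2\<close>.\<close>

definition defect :: "(complex \<Rightarrow> ennreal) \<Rightarrow> (complex \<Rightarrow> complex) \<Rightarrow> real" where
  "defect \<omega> f = real_energy \<omega> (\<lambda>z. z * f z) - real_energy \<omega> f"

lemma real_energy_nonneg: "real_energy \<omega> f \<ge> 0"
  by (simp add: real_energy_def)

lemma shift_domain_finite:
  assumes w: "superharmonic_weight \<omega>" and f: "f \<in> shift_domain \<omega>"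
  shows "f holomorphic_on unit_disk" "energy \<omega> f < \<infinity>" "energy \<omega> (\<lambda>z. z * f z) < \<infinity>" "(\<lambda>z. z * f z) \<in> shift_domain \<omega>"
proof -
  show hol: "f holomorphic_on unit_disk" and fin: "energy \<omega> (\<lambda>z. z * f z) < \<infinity>"
    using f by (auto simp: shift_domain_def)
  have "energy \<omega> (\<lambda>z. z\<^sup>2 * f z) + energy \<omega> f \<le> 2 * energy \<omega> (\<lambda>z. z * f z)"
    by (rule energy_concave[OF w hol])
  also have "\<dots> < \<infinity>" using fin by (simp add: ennreal_mult_less_top)
  finally have *: "energy \<omega> (\<lambda>z. z\<^sup>2 * f z) < \<infinity>" "energy \<omega> f < \<infinity>" by auto
  show "energy \<omega> f < \<infinity>" by fact
  show "(\<lambda>z. z * f z) \<in> shift_domain \<omega>"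
    using * hol by (auto simp: shift_domain_def power2_eq_square mult.assoc intro!: holomorphic_intros)
qed

lemma shift_domain_lincomb:
  assumes w: "superharmonic_weight \<omega>" and f: "f \<in> shift_domain \<omega>" and g: "g \<in> shift_domain \<omega>"
  shows "(\<lambda>z. a * f z + b * g z) \<in> shift_domain \<omega>"
proof -
  note F = shift_domain_finite[OF w f] and G = shift_domain_finite[OF w g]
  have "energy \<omega> (\<lambda>z. a * (z * f z) + b * (z * g z)) < \<infinity>"
    by (intro energy_lincomb_finite[OF w] F G holomorphic_intros)
  then show ?thesis
    using F(1) G(1) by (auto simp: shift_domain_def algebra_simps intro!: holomorphic_intros)
qed

lemma real_energy_concave:
  assumes w: "superharmonic_weight \<omega>" and f: "f \<in> shift_domain \<omega>"
  shows "real_energy \<omega> (\<lambda>z. z * (z * f z)) + real_energy \<omega> f \<le> 2 * real_energy \<omega> (\<lambda>z. z * f z)"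
proof -
  note F = shift_domain_finite[OF w f] and ZF = shift_domain_finite[OF w shift_domain_finite(4)[OF w f]]
  have "energy \<omega> (\<lambda>z. z * (z * f z)) + energy \<omega> f \<le> 2 * energy \<omega> (\<lambda>z. z * f z)"
    using energy_concave[OF w F(1)] by (simp add: power2_eq_square mult.assoc)
  then have "enn2real (energy \<omega> (\<lambda>z. z * (z * f z)) + energy \<omega> f) \<le> enn2real (2 * energy \<omega> (\<lambda>z. z * f z))"
    using F(3) by (intro enn2real_mono) (auto simp: ennreal_mult_less_top)
  then show ?thesis
    using F ZF by (simp add: real_energy_def enn2real_plus enn2real_mult)
qed

lemma defect_shift_le:
  assumes w: "superharmonic_weight \<omega>" and f: "f \<in> shift_domain \<omega>"
  shows "defect \<omega> (\<lambda>z. z * f z) \<le> defect \<omega> f"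
  using real_energy_concave[OF assms] by (simp add: defect_def)

text \<open>Under concavity a first decrease would recur at least as large at every step, and the
  sequence would fall below 0 at a linear rate.\<close>

lemma concave_nonneg_sequence_mono:
  fixes e :: "nat \<Rightarrow> real"
  assumes conc: "\<And>n. e (Suc (Suc n)) - e (Suc n) \<le> e (Suc n) - e n" and nonneg: "\<And>n. 0 \<le> e n"
  shows "e 0 \<le> e 1"
proof (rule ccontr)
  assume "\<not> e 0 \<le> e 1"
  then have neg: "e 0 - e 1 > 0" by simp
  have d: "e (Suc n) - e n \<le> e 1 - e 0" for n
  proof (induction n)
    case (Suc n)
    then show ?case using conc[of n] by linarith
  qed simp
  have le: "e n \<le> e 0 - real n * (e 0 - e 1)" for n
  proof (induction n)
    case (Suc n)
    then show ?case using d[of n] by (simp add: algebra_simps)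
  qed simp
  obtain n where "e 0 < real n * (e 0 - e 1)"
    using reals_Archimedean3[OF neg] by blast
  then show False using le[of n] nonneg[of n] by linarith
qed

lemma defect_nonneg:
  assumes w: "superharmonic_weight \<omega>" and f: "f \<in> shift_domain \<omega>"
  shows "0 \<le> defect \<omega> f"
proof -
  define F where "F = (\<lambda>n z. z ^ n * f z)"
  have F0: "F 0 = f" by (simp add: F_def)
  have FS: "F (Suc n) = (\<lambda>z. z * F n z)" for n by (auto simp: F_def)
  have dom: "F n \<in> shift_domain \<omega>" for n
    by (induction n) (auto simp only: F0 FS intro: f shift_domain_finite(4)[OF w])
  have "real_energy \<omega> (F 0) \<le> real_energy \<omega> (F 1)"
  proof (rule concave_nonneg_sequence_mono)
    fix n
    show "real_energy \<omega> (F (Suc (Suc n))) - real_energy \<omega> (F (Suc n)) \<le> real_energy \<omega> (F (Suc n)) - real_energy \<omega> (F n)"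
      using real_energy_concave[OF w dom[of n]] by (simp add: FS)
  qed (rule real_energy_nonneg)
  then show ?thesis by (simp add: defect_def F0 FS)
qed

text \<open>The weights \<open>1 / (m + 1)\<close> and \<open>1 / m\<close> are the ones for which the difference of the outer terms is
  exactly a multiple of a square; this is what makes the Cesaro means contractive.\<close>

lemma cmod_fejer_identity:
  fixes x y :: complex and m N :: real
  assumes "m > 0" "N > 0"
  shows "(cmod (of_real (m / N) * x + of_real (- 1 / N) * y))\<^sup>2 + 1 / (m + 1) * (cmod (1 * x + 1 * y))\<^sup>2
     + (1 / (m * (m + 1)) - 1 / N\<^sup>2) * (cmod (of_real m * x + of_real (- 1) * y))\<^sup>2
    = (cmod x)\<^sup>2 + 1 / m * (cmod y)\<^sup>2"
proof -
  have "m + 1 \<noteq> 0" "m \<noteq> 0" "N \<noteq> 0" using assms by auto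
  then show ?thesis
    unfolding cmod_power2 by (simp add: power2_eq_square divide_simps) (simp add: algebra_simps)
qed

text \<open>Condition m (m + 1) \<le> N^2 makes the third coefficient nonnegative, as
  \<open>energy_lincomb3\<close> demands. The literal factors \<open>1 *\<close> keep all
  combinations in the shape of \<open>deriv_lincomb\<close>.\<close>

lemma real_energy_fejer_identity:
  assumes w: "superharmonic_weight \<omega>" and f: "f holomorphic_on unit_disk" "energy \<omega> f < \<infinity>"
    and g: "g holomorphic_on unit_disk" "energy \<omega> g < \<infinity>"
    and m: "m > 0" "N > 0" "m * (m + 1) \<le> N\<^sup>2"
  shows "real_energy \<omega> (\<lambda>z. of_real (m / N) * f z + of_real (- 1 / N) * g z) + 1 / (m + 1) * real_energy \<omega> (\<lambda>z. 1 * f z + 1 * g z)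
     + (1 / (m * (m + 1)) - 1 / N\<^sup>2) * real_energy \<omega> (\<lambda>z. of_real m * f z + of_real (- 1) * g z)
    = real_energy \<omega> f + 1 / m * real_energy \<omega> g"
proof -
  define k where "k = 1 / (m * (m + 1)) - 1 / N\<^sup>2"
  have k: "k \<ge> 0" using m by (simp add: k_def frac_le)
  define A where "A = (\<lambda>z. of_real (m / N) * f z + of_real (- 1 / N) * g z)"
  define B where "B = (\<lambda>z. 1 * f z + 1 * g z)"
  define C where "C = (\<lambda>z. of_real m * f z + of_real (- 1) * g z)"
  have hol: "A holomorphic_on unit_disk" "B holomorphic_on unit_disk" "C holomorphic_on unit_disk"
    unfolding A_def B_def C_def by (intro holomorphic_intros f g)+
  have fin: "energy \<omega> A < \<infinity>" "energy \<omega> B < \<infinity>" "energy \<omega> C < \<infinity>"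
    unfolding A_def B_def C_def by (intro energy_lincomb_finite[OF w] f g)+
  have "ennreal 1 * energy \<omega> A + ennreal (1 / (m + 1)) * energy \<omega> B + ennreal k * energy \<omega> C
    = (\<integral>\<^sup>+z\<in>unit_disk. ennreal (1 * (cmod (deriv A z))\<^sup>2 + 1 / (m + 1) * (cmod (deriv B z))\<^sup>2 + k * (cmod (deriv C z))\<^sup>2) * \<omega> z \<partial>lborel)"
    using m k by (intro energy_lincomb3[OF w] hol) auto
  \<comment> \<open>The summand with coefficient 0 pads the right side to the three terms of
    \<open>energy_lincomb3\<close>.\<close>
  also have "\<dots> = (\<integral>\<^sup>+z\<in>unit_disk. ennreal (1 * (cmod (deriv f z))\<^sup>2 + 1 / m * (cmod (deriv g z))\<^sup>2 + 0 * (cmod (deriv f z))\<^sup>2) * \<omega> z \<partial>lborel)"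
  proof (rule nn_integral_cong)
    fix z :: complex
    show "ennreal (1 * (cmod (deriv A z))\<^sup>2 + 1 / (m + 1) * (cmod (deriv B z))\<^sup>2 + k * (cmod (deriv C z))\<^sup>2) * \<omega> z * indicator unit_disk z
      = ennreal (1 * (cmod (deriv f z))\<^sup>2 + 1 / m * (cmod (deriv g z))\<^sup>2 + 0 * (cmod (deriv f z))\<^sup>2) * \<omega> z * indicator unit_disk z"
    proof (cases "z \<in> unit_disk")
      case True
      have "1 * (cmod (deriv A z))\<^sup>2 + 1 / (m + 1) * (cmod (deriv B z))\<^sup>2 + k * (cmod (deriv C z))\<^sup>2
         = 1 * (cmod (deriv f z))\<^sup>2 + 1 / m * (cmod (deriv g z))\<^sup>2 + 0 * (cmod (deriv f z))\<^sup>2"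
        unfolding A_def B_def C_def k_def deriv_lincomb[OF f(1) g(1) True]
        using cmod_fejer_identity[OF m(1,2), of "deriv f z" "deriv g z"] by (simp only: mult_1 mult_zero_left add_0_right)
      then show ?thesis by (simp only:)
    qed simp
  qed
  also have "\<dots> = ennreal 1 * energy \<omega> f + ennreal (1 / m) * energy \<omega> g + ennreal 0 * energy \<omega> f"
    using m by (intro energy_lincomb3[OF w, symmetric] f g) auto
  finally have "enn2real (energy \<omega> A + ennreal (1 / (m + 1)) * energy \<omega> B + ennreal k * energy \<omega> C)
    = enn2real (energy \<omega> f + ennreal (1 / m) * energy \<omega> g)" by simp
  then have "real_energy \<omega> A + 1 / (m + 1) * real_energy \<omega> B + k * real_energy \<omega> C = real_energy \<omega> f + 1 / m * real_energy \<omega> g"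
    using fin f g m k by (simp add: real_energy_def enn2real_plus enn2real_mult ennreal_mult_less_top)
  then show ?thesis by (simp only: A_def B_def C_def k_def)
qed

text \<open>The energy identity holds for f, g and again for z f, z g; subtracting gives it for the
  defect. The third term is then dropped, both its coefficient and its defect being
  nonnegative.\<close>

lemma defect_fejer_le:
  assumes w: "superharmonic_weight \<omega>" and f: "f \<in> shift_domain \<omega>" and g: "g \<in> shift_domain \<omega>"
    and m: "m > 0" "N > 0" "m * (m + 1) \<le> N\<^sup>2"
  shows "defect \<omega> (\<lambda>z. of_real (m / N) * f z + of_real (- 1 / N) * g z) + 1 / (m + 1) * defect \<omega> (\<lambda>z. 1 * f z + 1 * g z)
    \<le> defect \<omega> f + 1 / m * defect \<omega> g"
proof -
  note F = shift_domain_finite[OF w f] and G = shift_domain_finite[OF w g]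
  define k where "k = 1 / (m * (m + 1)) - 1 / N\<^sup>2"
  have k: "k \<ge> 0" using m by (simp add: k_def frac_le)
  have hol: "(\<lambda>z. z * f z) holomorphic_on unit_disk" "(\<lambda>z. z * g z) holomorphic_on unit_disk"
    by (intro holomorphic_intros F G)+
  have z: "(\<lambda>z. z * (a * f z + b * g z)) = (\<lambda>z. a * (z * f z) + b * (z * g z))" for a b
    by (auto simp: algebra_simps)
  have "0 \<le> k * defect \<omega> (\<lambda>z. of_real m * f z + of_real (- 1) * g z)"
    by (intro mult_nonneg_nonneg k defect_nonneg[OF w] shift_domain_lincomb[OF w] f g)
  then show ?thesis
    using real_energy_fejer_identity[OF w F(1,2) G(1,2) m] real_energy_fejer_identity[OF w hol(1) F(3) hol(2) G(3) m]
    unfolding defect_def z k_def[symmetric] by (simp only: right_diff_distrib)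
qed

subsection \<open>Contractivity of the Cesaro means\<close>

lemma taylor_coeff_sums:
  assumes "f holomorphic_on unit_disk" "z \<in> unit_disk"
  shows "(\<lambda>k. taylor_coeff f k * z ^ k) sums f z"
  using holomorphic_power_series[OF assms] by (simp add: taylor_coeff_def)

text \<open>The k-fold backward shift of f.\<close>

definition taylor_tail :: "(complex \<Rightarrow> complex) \<Rightarrow> nat \<Rightarrow> complex \<Rightarrow> complex" where
  "taylor_tail f k z = (\<Sum>j. taylor_coeff f (j + k) * z ^ j)"

lemma taylor_tail_0:
  assumes "f holomorphic_on unit_disk" "z \<in> unit_disk"
  shows "taylor_tail f 0 z = f z"
  using taylor_coeff_sums[OF assms] by (simp add: taylor_tail_def sums_iff)

lemma summable_taylor_tail:
  assumes "f holomorphic_on unit_disk" "z \<in> unit_disk"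
  shows "summable (\<lambda>j. taylor_coeff f (j + k) * z ^ j)"
  using taylor_coeff_sums[OF assms] by (subst summable_powser_ignore_initial_segment) (simp add: sums_iff)

lemma taylor_tail_Suc:
  assumes "f holomorphic_on unit_disk" "z \<in> unit_disk"
  shows "taylor_tail f k z = taylor_coeff f k + z * taylor_tail f (Suc k) z"
  using powser_split_head(1)[OF summable_taylor_tail[OF assms, of k]] by (simp add: taylor_tail_def)

lemma taylor_tail_holomorphic:
  assumes "f holomorphic_on unit_disk"
  shows "taylor_tail f k holomorphic_on unit_disk"
proof (rule power_series_holomorphic)
  fix z assume "z \<in> unit_disk"
  then show "(\<lambda>j. taylor_coeff f (j + k) * (z - 0) ^ j) sums taylor_tail f k z"
    using summable_taylor_tail[OF assms, of z k] by (simp add: taylor_tail_def summable_sums)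
qed

text \<open>Removing a constant term preserves energy, so finiteness passes from the k-th tail to z
  times the next one; concavity then removes the factor z.\<close>

lemma taylor_tail_shift_domain:
  assumes w: "superharmonic_weight \<omega>" and f: "f holomorphic_on unit_disk" and fin: "energy \<omega> f < \<infinity>"
  shows "energy \<omega> (taylor_tail f k) < \<infinity>" "taylor_tail f (Suc k) \<in> shift_domain \<omega>"
    "energy \<omega> (\<lambda>z. z * taylor_tail f (Suc k) z) = energy \<omega> (taylor_tail f k)"
proof -
  have eq: "energy \<omega> (taylor_tail f k) = energy \<omega> (\<lambda>z. z * taylor_tail f (Suc k) z)" for k
  proof -
    have "energy \<omega> (taylor_tail f k) = energy \<omega> (\<lambda>z. taylor_coeff f k + z * taylor_tail f (Suc k) z)"
      by (rule energy_cong) (rule taylor_tail_Suc[OF f])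
    also have "\<dots> = energy \<omega> (\<lambda>z. z * taylor_tail f (Suc k) z)"
      by (intro energy_add_const holomorphic_intros taylor_tail_holomorphic[OF f])
    finally show ?thesis .
  qed
  have dom: "taylor_tail f (Suc k) \<in> shift_domain \<omega>" if "energy \<omega> (taylor_tail f k) < \<infinity>" for k
    using that taylor_tail_holomorphic[OF f, of "Suc k"] by (simp add: shift_domain_def eq)
  have fin': "energy \<omega> (taylor_tail f k) < \<infinity>" for k
  proof (induction k)
    case 0
    then show ?case using fin energy_cong[of "taylor_tail f 0" f \<omega>] taylor_tail_0[OF f] by simp
  next
    case (Suc k)
    then show ?case using shift_domain_finite(2)[OF w dom] by blast
  qed
  then show "energy \<omega> (taylor_tail f k) < \<infinity>" "taylor_tail f (Suc k) \<in> shift_domain \<omega>"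
    "energy \<omega> (\<lambda>z. z * taylor_tail f (Suc k) z) = energy \<omega> (taylor_tail f k)"
    using dom eq by auto
qed

text \<open>\<open>fejer_tail f n i\<close> is the sum of \<open>z ^ (i - j) * taylor_tail f (n + 1 - j)\<close> over \<open>j < i\<close>; the
  Cesaro mean is \<open>f - fejer_tail f n (n + 1) / (n + 1)\<close>. Counting from the top makes the recursion
  run in the direction of the induction.\<close>

primrec fejer_tail :: "(complex \<Rightarrow> complex) \<Rightarrow> nat \<Rightarrow> nat \<Rightarrow> complex \<Rightarrow> complex" where
  "fejer_tail f n 0 = (\<lambda>_. 0)"
| "fejer_tail f n (Suc i) = (\<lambda>z. z * (taylor_tail f (n + 1 - i) z + fejer_tail f n i z))"

lemma fejer_tail_sum: "fejer_tail f n i z = (\<Sum>j<i. z ^ (i - j) * taylor_tail f (n + 1 - j) z)"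
proof (induction i)
  case (Suc i)
  have "z * (\<Sum>j<i. z ^ (i - j) * taylor_tail f (n + 1 - j) z) = (\<Sum>j<i. z ^ (Suc i - j) * taylor_tail f (n + 1 - j) z)"
    unfolding sum_distrib_left by (intro sum.cong) (auto simp: Suc_diff_le)
  with Suc show ?case by (simp add: algebra_simps)
qed simp

lemma partial_sum_taylor_tail:
  assumes "f holomorphic_on unit_disk" "z \<in> unit_disk"
  shows "f z = partial_sum k f z + z ^ Suc k * taylor_tail f (Suc k) z"
proof (induction k)
  case 0
  then show ?case using taylor_tail_Suc[OF assms, of 0] taylor_tail_0[OF assms] by (simp add: partial_sum_def)
next
  case (Suc k)
  then show ?case using taylor_tail_Suc[OF assms, of "Suc k"] by (simp add: partial_sum_def algebra_simps)
qed

text \<open>Average f - s_j, which is z^(j+1) times the tail of order j + 1, over j \<le> n, and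
  reverse the order of summation.\<close>

lemma cesaro_mean_fejer_tail:
  assumes f: "f holomorphic_on unit_disk" and z: "z \<in> unit_disk"
  shows "cesaro_mean n f z = f z - fejer_tail f n (n + 1) z / of_nat (n + 1)"
proof -
  have "fejer_tail f n (n + 1) z = (\<Sum>j<n+1. z ^ Suc (n - j) * taylor_tail f (Suc (n - j)) z)"
    unfolding fejer_tail_sum by (intro sum.cong) (auto simp: Suc_diff_le)
  also have "\<dots> = (\<Sum>j<n+1. z ^ Suc j * taylor_tail f (Suc j) z)"
    using sum.nat_diff_reindex[of "\<lambda>j. z ^ Suc j * taylor_tail f (Suc j) z" "n + 1"] by simp
  also have "\<dots> = (\<Sum>j\<le>n. f z - partial_sum j f z)"
    using partial_sum_taylor_tail[OF f z] by (intro sum.cong) (auto simp: algebra_simps)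
  also have "\<dots> = of_nat (n + 1) * f z - (\<Sum>j\<le>n. partial_sum j f z)"
    by (simp add: sum_subtractf)
  finally have "(\<Sum>j\<le>n. partial_sum j f z) = of_nat (n + 1) * f z - fejer_tail f n (n + 1) z" by simp
  moreover have "(of_nat (n + 1) :: complex) \<noteq> 0" by (simp only: of_nat_eq_0_iff)
  moreover have "S / x = a - b / x" if "S = x * a - b" "x \<noteq> 0" for S x a b :: complex
    using that by (simp add: field_simps)
  ultimately show ?thesis unfolding cesaro_mean_def by blast
qed

text \<open>\<open>G i\<close> and \<open>P i\<close> are the Taylor tails of order n + 1 - i of f
  and of its Cesaro mean, and the invariant for i \<ge> 1 is D(P i) + q(W i) / i \<le> D(G i).
  Passing to i + 1 adds q(P i) on the left and q(G i) on the right. The inequality of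
  \<open>defect_fejer_le\<close> with m = i and N = n + 1 trades these against q(W i) / i and q(G i
  + W i) / (i + 1), and the latter dominates q(W (i + 1)) / (i + 1) because \<open>W (Suc i)\<close>
  is z times \<open>G i + W i\<close>.\<close>

lemma energy_cesaro_mean_le:
  assumes w: "superharmonic_weight \<omega>" and f: "f holomorphic_on unit_disk" and fin: "energy \<omega> f < \<infinity>"
  shows "energy \<omega> (cesaro_mean n f) \<le> energy \<omega> f"
proof -
  define N where "N = real n + 1"
  define G where "G = (\<lambda>i. taylor_tail f (n + 1 - i))"
  define W where "W = fejer_tail f n"
  define P where "P = (\<lambda>i z. of_real (real i / N) * G i z + of_real (- 1 / N) * W i z)"
  have N: "N > 0" by (simp add: N_def)
  note tail = taylor_tail_shift_domain[OF w f fin]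
  have GS: "G (Suc i) = taylor_tail f (n - i)" "G i = taylor_tail f (Suc (n - i))" if "i \<le> n" for i
    using that by (auto simp: G_def Suc_diff_le)
  have Gdom: "G i \<in> shift_domain \<omega>" if "i \<le> n" for i
    unfolding GS(2)[OF that] by (rule tail(2))
  have zero: "(\<lambda>_. 0) \<in> shift_domain \<omega>"
    by (simp add: shift_domain_def energy_def)
  have Wdom: "W i \<in> shift_domain \<omega>" if "i \<le> n + 1" for i
    using that
  proof (induction i)
    case 0
    then show ?case using zero by (simp add: W_def)
  next
    case (Suc i)
    then have "(\<lambda>z. 1 * G i z + 1 * W i z) \<in> shift_domain \<omega>"
      by (intro shift_domain_lincomb[OF w] Gdom) auto
    then show ?case
      using shift_domain_finite(4)[OF w] by (auto simp: W_def G_def)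
  qed
  have GE: "real_energy \<omega> (G (Suc i)) = real_energy \<omega> (G i) + defect \<omega> (G i)" if "i \<le> n" for i
    using tail(3)[of "n - i"] that by (simp add: defect_def real_energy_def GS)
  have W_S: "W (Suc i) = (\<lambda>z. z * (1 * G i z + 1 * W i z))" for i
    by (simp add: W_def G_def)
  have Pdom: "P i \<in> shift_domain \<omega>" if "i \<le> n" for i
    unfolding P_def using that by (intro shift_domain_lincomb[OF w] Gdom Wdom) auto
  have P_S: "energy \<omega> (P (Suc i)) = energy \<omega> (\<lambda>z. z * P i z)" if i: "i \<le> n" for i
  proof -
    \<comment> \<open>(i + 1) / N is the Fejer weight of the Taylor coefficient of order n -
      i.\<close>
    have "energy \<omega> (P (Suc i)) = energy \<omega> (\<lambda>z. of_real (real (Suc i) / N) * taylor_coeff f (n - i) + z * P i z)"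
    proof (rule energy_cong)
      fix z :: complex assume z: "z \<in> unit_disk"
      have "G (Suc i) z = taylor_coeff f (n - i) + z * G i z"
        unfolding GS[OF i] by (rule taylor_tail_Suc[OF f z])
      then show "P (Suc i) z = of_real (real (Suc i) / N) * taylor_coeff f (n - i) + z * P i z"
        using N by (simp add: P_def W_S field_simps)
    qed
    also have "\<dots> = energy \<omega> (\<lambda>z. z * P i z)"
      using shift_domain_finite(1)[OF w Pdom[OF i]] by (intro energy_add_const holomorphic_intros)
    finally show ?thesis .
  qed
  \<comment> \<open>The induction starts at index 1, where the weight 1 / i first makes sense. There
    \<open>P\<close> is constant, and the whole defect of \<open>G 0\<close> is available to bound
    that of \<open>W 1\<close>.\<close>
  have claim: "real_energy \<omega> (P (Suc i)) + 1 / (real i + 1) * defect \<omega> (W (Suc i)) \<le> real_energy \<omega> (G (Suc i))" if "i \<le> n" for i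
    using that
  proof (induction i)
    case 0
    have "energy \<omega> (P (Suc 0)) = energy \<omega> (\<lambda>_. 0)"
    proof -
      have "P 0 = (\<lambda>_. 0)" by (simp add: P_def W_def)
      then show ?thesis using P_S[of 0] by simp
    qed
    then have "real_energy \<omega> (P (Suc 0)) = 0" by (simp add: real_energy_def energy_def)
    moreover have "defect \<omega> (W (Suc 0)) \<le> defect \<omega> (G 0)"
      using defect_shift_le[OF w Gdom[of 0]] by (simp add: W_def G_def)
    ultimately show ?case
      using GE[of 0] real_energy_nonneg[of \<omega> "G 0"] by simp
  next
    case (Suc i)
    define m where "m = real i + 1"
    have m: "m > 0" "m * (m + 1) \<le> N\<^sup>2"
    proof -
      show "m > 0" by (simp add: m_def)
      have "m \<le> N" "m + 1 \<le> N" using Suc.prems by (auto simp: m_def N_def)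
      then show "m * (m + 1) \<le> N\<^sup>2" unfolding power2_eq_square using \<open>m > 0\<close> by (intro mult_mono) auto
    qed
    have i: "Suc i \<le> n" "Suc i \<le> n + 1" using Suc.prems by auto
    have P: "P (Suc i) = (\<lambda>z. of_real (m / N) * G (Suc i) z + of_real (- 1 / N) * W (Suc i) z)"
      by (simp add: P_def m_def add.commute)
    have "real_energy \<omega> (P (Suc (Suc i))) = real_energy \<omega> (P (Suc i)) + defect \<omega> (P (Suc i))"
      using P_S[OF i(1)] by (simp add: defect_def real_energy_def)
    moreover have "defect \<omega> (W (Suc (Suc i))) \<le> defect \<omega> (\<lambda>z. 1 * G (Suc i) z + 1 * W (Suc i) z)"
      unfolding W_S[of "Suc i"] by (intro defect_shift_le[OF w] shift_domain_lincomb[OF w] Gdom Wdom i)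
    then have "1 / (m + 1) * defect \<omega> (W (Suc (Suc i))) \<le> 1 / (m + 1) * defect \<omega> (\<lambda>z. 1 * G (Suc i) z + 1 * W (Suc i) z)"
      using m(1) by (intro mult_left_mono) auto
    moreover have "defect \<omega> (P (Suc i)) + 1 / (m + 1) * defect \<omega> (\<lambda>z. 1 * G (Suc i) z + 1 * W (Suc i) z)
       \<le> defect \<omega> (G (Suc i)) + 1 / m * defect \<omega> (W (Suc i))"
      unfolding P by (intro defect_fejer_le[OF w] Gdom Wdom i m N)
    moreover have "real_energy \<omega> (P (Suc i)) + 1 / m * defect \<omega> (W (Suc i)) \<le> real_energy \<omega> (G (Suc i))"
      using Suc by (simp add: m_def)
    moreover have "real_energy \<omega> (G (Suc (Suc i))) = real_energy \<omega> (G (Suc i)) + defect \<omega> (G (Suc i))"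
      by (rule GE[OF i(1)])
    ultimately have "real_energy \<omega> (P (Suc (Suc i))) + 1 / (m + 1) * defect \<omega> (W (Suc (Suc i))) \<le> real_energy \<omega> (G (Suc (Suc i)))"
      by linarith
    then show ?case by (simp add: m_def add.commute)
  qed
  have "0 \<le> 1 / (real n + 1) * defect \<omega> (W (Suc n))"
    by (intro mult_nonneg_nonneg defect_nonneg[OF w] Wdom) auto
  then have le: "real_energy \<omega> (P (Suc n)) \<le> real_energy \<omega> (G (Suc n))"
    using claim[of n] by linarith
  have "energy \<omega> (P (Suc n)) < \<infinity>"
    using P_S[of n] shift_domain_finite(3)[OF w Pdom[of n]] by simp
  moreover have "energy \<omega> (G (Suc n)) = energy \<omega> f"
    by (rule energy_cong) (simp add: G_def taylor_tail_0[OF f])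
  moreover have "energy \<omega> (P (Suc n)) = energy \<omega> (cesaro_mean n f)"
  proof (rule energy_cong)
    fix z :: complex assume z: "z \<in> unit_disk"
    have "1 + complex_of_nat n \<noteq> 0" by (metis of_nat_Suc of_nat_eq_0_iff nat.distinct(1))
    then show "P (Suc n) z = cesaro_mean n f z"
      using cesaro_mean_fejer_tail[OF f z, of n] taylor_tail_0[OF f z] N
      by (simp add: P_def G_def W_def N_def add.commute del: fejer_tail.simps)
  qed
  ultimately have PG: "energy \<omega> (cesaro_mean n f) = ennreal (real_energy \<omega> (P (Suc n)))"
    "energy \<omega> f = ennreal (real_energy \<omega> (G (Suc n)))"
    using fin by (simp_all add: real_energy_def)
  show ?thesis unfolding PG by (rule ennreal_leI[OF le])
qed

subsection \<open>Convergence of the Cesaro means\<close>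

lemma LIMSEQ_cesaro:
  fixes x :: "nat \<Rightarrow> complex"
  assumes "x \<longlonglongrightarrow> L"
  shows "(\<lambda>n. (\<Sum>k\<le>n. x k) / of_nat (n + 1)) \<longlonglongrightarrow> L"
proof (rule LIMSEQ_I)
  fix e :: real assume e: "e > 0"
  obtain M where M: "\<And>k. k \<ge> M \<Longrightarrow> cmod (x k - L) < e / 2"
    using LIMSEQ_D[OF assms, of "e/2"] e by auto
  define A where "A = (\<Sum>k<M. cmod (x k - L))"
  have A0: "A \<ge> 0" unfolding A_def by (intro sum_nonneg) auto
  obtain K :: nat where K: "A / (e / 2) < real K" using reals_Archimedean2 by blast
  show "\<exists>no. \<forall>n\<ge>no. cmod ((\<Sum>k\<le>n. x k) / of_nat (n + 1) - L) < e"
  proof (intro exI allI impI)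
    fix n assume n: "n \<ge> max K M"
    have "(\<Sum>k\<le>n. x k) / of_nat (n + 1) - L = (\<Sum>k\<le>n. x k - L) / of_nat (n + 1)"
    proof -
      have "(of_nat (n + 1) :: complex) \<noteq> 0" by (simp only: of_nat_eq_0_iff)
      moreover have "(\<Sum>k\<le>n. x k - L) = (\<Sum>k\<le>n. x k) - of_nat (n + 1) * L" by (simp add: sum_subtractf)
      moreover have "S / c - L = (S - c * L) / c" if "c \<noteq> 0" for S c L :: complex
        using that by (simp add: field_simps)
      ultimately show ?thesis by simp
    qed
    then have "cmod ((\<Sum>k\<le>n. x k) / of_nat (n + 1) - L) = cmod (\<Sum>k\<le>n. x k - L) / (real n + 1)"
      by (metis norm_divide norm_of_nat of_nat_1 of_nat_add)
    also have "\<dots> \<le> (\<Sum>k\<le>n. cmod (x k - L)) / (real n + 1)"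
      by (intro divide_right_mono norm_sum) auto
    also have "(\<Sum>k\<le>n. cmod (x k - L)) = (\<Sum>k<M. cmod (x k - L)) + (\<Sum>k\<in>{M..n}. cmod (x k - L))"
      using n by (subst sum.union_disjoint[symmetric]) (auto intro!: sum.cong)
    also have "\<dots> \<le> A + (\<Sum>k\<in>{M..n}. e / 2)"
      unfolding A_def using M by (intro add_left_mono sum_mono) (auto intro: less_imp_le)
    also have "\<dots> \<le> A + (real n + 1) * (e / 2)"
      using e n by simp
    also have "(A + (real n + 1) * (e / 2)) / (real n + 1) < e"
    proof -
      have "A < real K * (e / 2)" using K e by (simp add: field_simps)
      also have "\<dots> \<le> (real n + 1) * (e / 2)" using n e by (intro mult_right_mono) auto
      finally show ?thesis by (simp add: field_simps)
    qed
    finally show "cmod ((\<Sum>k\<le>n. x k) / of_nat (n + 1) - L) < e"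
      by (simp add: divide_right_mono)
  qed
qed

section \<open>Pointwise convergence of derivatives and lower semicontinuity of the energy\<close>

lemma partial_sum_holomorphic: "partial_sum k f holomorphic_on A"
  unfolding partial_sum_def[abs_def] by (intro holomorphic_intros)

lemma cesaro_mean_holomorphic: "cesaro_mean k f holomorphic_on A"
  unfolding cesaro_mean_def[abs_def]
  by (intro holomorphic_intros partial_sum_holomorphic) (simp only: of_nat_eq_0_iff)

lemma LIMSEQ_deriv_partial_sum:
  assumes f: "f holomorphic_on unit_disk" and z: "z \<in> unit_disk"
  shows "(\<lambda>k. deriv (partial_sum k f) z) \<longlonglongrightarrow> deriv f z"
proof -
  have "(\<lambda>k. (deriv ^^ k) (deriv f) 0 / fact k * (z - 0) ^ k) sums deriv f z"
    using f z by (intro holomorphic_power_series holomorphic_deriv) auto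
  moreover have "(deriv ^^ k) (deriv f) 0 / fact k = of_nat (Suc k) * taylor_coeff f (Suc k)" for k
  proof -
    have *: "x / b = c * (x / (c * b))" if "c \<noteq> 0" for x b c :: complex using that by simp
    show ?thesis
      unfolding taylor_coeff_def funpow_Suc_right o_def of_nat_fact unfolding fact_Suc
      by (rule *) (rule of_nat_neq_0)
  qed
  ultimately have "(\<lambda>n. \<Sum>k<n. of_nat (Suc k) * taylor_coeff f (Suc k) * z ^ k) \<longlonglongrightarrow> deriv f z"
    by (simp add: sums_def)
  moreover have "deriv (partial_sum n f) z = (\<Sum>k<n. of_nat (Suc k) * taylor_coeff f (Suc k) * z ^ k)" for n
  proof -
    have "(partial_sum n f has_field_derivative (\<Sum>k\<le>n. taylor_coeff f k * (of_nat k * z ^ (k - 1)))) (at z)"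
      unfolding partial_sum_def[abs_def] by (auto intro!: derivative_eq_intros sum.cong)
    then have "deriv (partial_sum n f) z = (\<Sum>k\<le>n. taylor_coeff f k * (of_nat k * z ^ (k - 1)))"
      by (rule DERIV_imp_deriv)
    also have "\<dots> = (\<Sum>k<n. of_nat (Suc k) * taylor_coeff f (Suc k) * z ^ k)"
      by (subst sum.atMost_shift) (auto intro!: sum.cong)
    finally show ?thesis .
  qed
  ultimately show ?thesis by simp
qed

lemma LIMSEQ_deriv_cesaro_mean:
  assumes f: "f holomorphic_on unit_disk" and z: "z \<in> unit_disk"
  shows "(\<lambda>n. deriv (cesaro_mean n f) z) \<longlonglongrightarrow> deriv f z"
proof -
  have "deriv (cesaro_mean n f) z = (\<Sum>k\<le>n. deriv (partial_sum k f) z) / of_nat (n + 1)" for n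
  proof -
    have "(partial_sum k f has_field_derivative deriv (partial_sum k f) z) (at z)" for k
      using holomorphic_derivI[OF partial_sum_holomorphic open_ball z] .
    then have "((\<lambda>z. (\<Sum>k\<le>n. partial_sum k f z) / of_nat (n + 1)) has_field_derivative
        (\<Sum>k\<le>n. deriv (partial_sum k f) z) / of_nat (n + 1)) (at z)"
      by (intro DERIV_cdivide DERIV_sum)
    then show ?thesis
      unfolding cesaro_mean_def[abs_def] by (rule DERIV_imp_deriv)
  qed
  then show ?thesis
    using LIMSEQ_cesaro[OF LIMSEQ_deriv_partial_sum[OF f z]] by simp
qed

lemma energy_liminf:
  assumes w: "superharmonic_weight \<omega>" and F: "\<And>n. F n holomorphic_on unit_disk"
    and lim: "\<And>z. z \<in> unit_disk \<Longrightarrow> (\<lambda>n. deriv (F n) z) \<longlonglongrightarrow> deriv f z"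
  shows "energy \<omega> f \<le> liminf (\<lambda>n. energy \<omega> (F n))"
proof -
  define W where "W = (\<lambda>z. \<omega> z * indicator unit_disk z)"
  have [measurable]: "W \<in> borel_measurable borel"
    unfolding W_def by (rule superharmonic_weight_measurable[OF w])
  define D where "D = (\<lambda>f z. indicator unit_disk z * (cmod (deriv f z))\<^sup>2 :: real)"
  have Dm[measurable]: "D (F n) \<in> borel_measurable borel" for n
    unfolding D_def by (intro borel_measurable_deriv_square F)
  have E: "energy \<omega> f = (\<integral>\<^sup>+z. ennreal (D f z) * W z \<partial>lborel)" for f
    unfolding energy_def D_def W_def by (intro nn_integral_cong) (auto simp: indicator_def)
  have "ennreal (D f z) * W z \<le> liminf (\<lambda>n. ennreal (D (F n) z) * W z)" for z
  \<comment> \<open>The weight may be infinite at z, and multiplication in \<open>ennreal\<close> is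
    discontinuous at 0 times infinity; where the limit derivative vanishes the left side is simply
    0.\<close>
  proof (cases "z \<in> unit_disk \<and> D f z \<noteq> 0")
    case True
    then have "(\<lambda>n. D (F n) z) \<longlonglongrightarrow> D f z"
      unfolding D_def by (intro tendsto_intros lim) auto
    then have "(\<lambda>n. ennreal (D (F n) z) * W z) \<longlonglongrightarrow> ennreal (D f z) * W z"
      using True by (intro tendsto_mult_ennreal tendsto_ennrealI tendsto_const) (auto simp: D_def)
    then show ?thesis using lim_imp_Liminf[of sequentially] by fastforce
  qed (auto simp: D_def)
  then have "energy \<omega> f \<le> (\<integral>\<^sup>+z. liminf (\<lambda>n. ennreal (D (F n) z) * W z) \<partial>lborel)"
    unfolding E by (intro nn_integral_mono)
  also have "\<dots> \<le> liminf (\<lambda>n. \<integral>\<^sup>+z. ennreal (D (F n) z) * W z \<partial>lborel)"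
    by (rule nn_integral_liminf) measurable
  finally show ?thesis unfolding E .
qed

text \<open>Contractivity bounds A + B by 4 e in the parallelogram law. The derivatives of the
  functions in B tend to 2 f', so Fatou gives 4 e \<le> liminf B, and nothing is left for A in the
  limit.\<close>

lemma energy_cesaro_mean_diff_tendsto_0:
  assumes w: "superharmonic_weight \<omega>" and f: "f holomorphic_on unit_disk" and fin: "energy \<omega> f < \<infinity>"
  shows "(\<lambda>n. energy \<omega> (\<lambda>z. cesaro_mean n f z - f z)) \<longlonglongrightarrow> 0"
proof -
  define e where "e = enn2real (energy \<omega> f)"
  have e: "energy \<omega> f = ennreal e" "e \<ge> 0" using fin by (auto simp: e_def)
  define A where "A = (\<lambda>n. energy \<omega> (\<lambda>z. cesaro_mean n f z - f z))"
  define B where "B = (\<lambda>n. energy \<omega> (\<lambda>z. cesaro_mean n f z + f z))"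
  have AB: "A n + B n \<le> ennreal (4 * e)" for n
  proof -
    have "A n + B n = 2 * energy \<omega> (cesaro_mean n f) + 2 * energy \<omega> f"
      unfolding A_def B_def by (rule energy_parallelogram[OF w cesaro_mean_holomorphic f])
    also have "\<dots> \<le> 2 * energy \<omega> f + 2 * energy \<omega> f"
      by (intro add_right_mono mult_left_mono energy_cesaro_mean_le[OF w f fin]) simp
    also have "\<dots> = ennreal (4 * e)"
      using e(2) unfolding e(1) by (simp add: ennreal_mult distrib_right[symmetric])
    finally show ?thesis .
  qed
  have lim: "ennreal (4 * e) \<le> liminf B"
  proof -
    have "ennreal (4 * e) = energy \<omega> (\<lambda>z. 2 * f z)"
      using energy_cmult[OF w f, of 2] e by (simp add: ennreal_mult)
    also have "\<dots> \<le> liminf B"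
      unfolding B_def
    proof (rule energy_liminf[OF w])
      fix n show "(\<lambda>z. cesaro_mean n f z + f z) holomorphic_on unit_disk"
        by (intro holomorphic_intros cesaro_mean_holomorphic f)
    next
      fix z :: complex assume z: "z \<in> unit_disk"
      have "(\<lambda>n. deriv (cesaro_mean n f) z + deriv f z) \<longlonglongrightarrow> deriv f z + deriv f z"
        by (intro tendsto_add LIMSEQ_deriv_cesaro_mean[OF f z] tendsto_const)
      then show "(\<lambda>n. deriv (\<lambda>z. cesaro_mean n f z + f z) z) \<longlonglongrightarrow> deriv (\<lambda>z. 2 * f z) z"
        using deriv_lincomb[OF cesaro_mean_holomorphic f z, of 1 _ _ 1] deriv_lincomb[OF f f z, of 1 1] by simp
    qed
    finally show ?thesis .
  qed
  have "A \<longlonglongrightarrow> 0"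
  proof (rule order_tendstoI)
    fix c :: ennreal assume c: "c > 0"
    obtain d where d: "d > 0" "ennreal d \<le> c"
    proof (cases c)
      case (real r)
      then show ?thesis using c that[of r] by (auto simp: ennreal_less_iff)
    next
      case top
      then show ?thesis using that[of 1] by auto
    qed
    \<comment> \<open>If 4 e < d, \<open>ennreal (4 * e - d)\<close> would be truncated to 0 and,
      for e = 0, not lie strictly below 4 e. In that case A \<le> 4 e < d holds at once.\<close>
    show "\<forall>\<^sub>F n in sequentially. A n < c"
    proof (cases "4 * e < d")
      case True
      have "A n < c" for n
      proof -
        have "A n \<le> A n + B n" by simp
        also note AB[of n]
        also have "ennreal (4 * e) < ennreal d" using True d(1) e(2) by (simp add: ennreal_less_iff)
        also note d(2)
        finally show ?thesis .
      qed
      then show ?thesis by simp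
    next
      case False
      then have "ennreal (4 * e - d) < ennreal (4 * e)" using d(1) by (intro ennreal_lessI) auto
      then have "ennreal (4 * e - d) < liminf B" using lim by (rule less_le_trans)
      then have "\<forall>\<^sub>F n in sequentially. ennreal (4 * e - d) < B n" by (rule less_LiminfD)
      then show ?thesis
      proof eventually_elim
        fix n assume B: "ennreal (4 * e - d) < B n"
        have "A n < ennreal d"
        proof (rule ccontr)
          assume "\<not> A n < ennreal d"
          then have "ennreal d \<le> A n" by simp
          have "A n + B n < top" using AB[of n] by (rule le_less_trans) simp
          then obtain a b where ab: "A n = ennreal a" "B n = ennreal b" "a \<ge> 0" "b \<ge> 0"
            by (cases "A n"; cases "B n") auto
          have "d \<le> a" using \<open>ennreal d \<le> A n\<close> ab by (simp add: ennreal_le_iff)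
          moreover have "4 * e - d < b" using B ab False by (simp add: ennreal_less_iff)
          moreover have "a + b \<le> 4 * e"
            using AB[of n] ab e(2) by (simp add: ennreal_plus[symmetric] ennreal_le_iff del: ennreal_plus)
          ultimately show False by linarith
        qed
        then show "A n < c" using d(2) by (rule less_le_trans)
      qed
    qed
  qed simp
  then show ?thesis by (simp add: A_def)
qed

lemma D_norm_sq_cesaro_mean_tendsto_0:
  assumes w: "superharmonic_weight \<omega>" and f: "in_D \<omega> f"
  shows "(\<lambda>n. D_norm_sq \<omega> (\<lambda>z. cesaro_mean n f z - f z)) \<longlonglongrightarrow> 0"
proof -
  have hol: "f holomorphic_on unit_disk" using f by (simp add: in_D_def)
  have "energy \<omega> f / ennreal pi < \<infinity>" using f by (simp add: in_D_def dirichlet_integral_energy)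
  then have fin: "energy \<omega> f < \<infinity>"
    by (cases "energy \<omega> f = top") (auto simp: divide_ennreal_def ennreal_top_mult inverse_ennreal less_top[symmetric])
  have "partial_sum k f 0 = f 0" for k
    using partial_sum_taylor_tail[OF hol, of 0 k] by simp
  then have "cesaro_mean n f 0 = f 0" for n
    unfolding cesaro_mean_def using of_nat_neq_0[of n, where 'a = complex] by (simp add: divide_eq_eq)
  then have "D_norm_sq \<omega> (\<lambda>z. cesaro_mean n f z - f z) = energy \<omega> (\<lambda>z. cesaro_mean n f z - f z) / ennreal pi" for n
    by (simp add: D_norm_sq_def dirichlet_integral_energy)
  moreover have "(\<lambda>n. energy \<omega> (\<lambda>z. cesaro_mean n f z - f z) * inverse (ennreal pi)) \<longlonglongrightarrow> 0 * inverse (ennreal pi)"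
    by (intro tendsto_mult_ennreal energy_cesaro_mean_diff_tendsto_0[OF w hol fin] tendsto_const) (auto simp: inverse_ennreal)
  ultimately show ?thesis by (simp add: divide_ennreal_def)
qed

subsection \<open>The Poisson kernel at 1\<close>

lemma has_integral_circle_mean:
  fixes g :: "complex \<Rightarrow> complex"
  assumes g: "g holomorphic_on cball a r" and r: "0 < r"
  shows "((\<lambda>t. g (a + of_real r * cis t)) has_integral of_real (2 * pi) * g a) {0..2*pi}"
proof -
  have "((\<lambda>u. g u / (u - a)) has_contour_integral (2 * of_real pi * \<i> * g a)) (circlepath a r)"
    using r by (intro Cauchy_integral_circlepath_simple[OF g]) auto
  then have "((\<lambda>t. g (a + r * cis t) / (a + r * cis t - a) * r * \<i> * cis t) has_integral (2 * of_real pi * \<i> * g a)) {0..2*pi}"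
    unfolding circlepath_def by (subst (asm) has_contour_integral_part_circlepath_iff) auto
  moreover have "g (a + r * cis t) / (a + r * cis t - a) * r * \<i> * cis t = \<i> * g (a + r * cis t)" for t
    using r by (simp add: field_simps)
  ultimately have "((\<lambda>t. \<i> * g (a + r * cis t)) has_integral (2 * of_real pi * \<i> * g a)) {0..2*pi}"
    by (simp only:)
  then have "((\<lambda>t. - \<i> * (\<i> * g (a + r * cis t))) has_integral (- \<i> * (2 * of_real pi * \<i> * g a))) {0..2*pi}"
    by (rule has_integral_mult_right)
  moreover have "- \<i> * (\<i> * x) = x" for x by (simp add: mult.assoc[symmetric])
  moreover have "- \<i> * (2 * of_real pi * \<i> * g a) = of_real (2 * pi) * g a" by (simp add: algebra_simps)
  ultimately show ?thesis by (simp only:)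
qed

lemma nn_integral_circle_mean:
  assumes g: "g holomorphic_on cball a r" and r: "0 < r" and nonneg: "\<And>z. z \<in> cball a r \<Longrightarrow> 0 \<le> Re (g z)"
  shows "(\<integral>\<^sup>+t\<in>{0..2*pi}. ennreal (Re (g (a + of_real r * cis t))) \<partial>lborel) / ennreal (2*pi) = ennreal (Re (g a))"
proof -
  have int: "((\<lambda>t. Re (g (a + of_real r * cis t))) has_integral Re (of_real (2 * pi) * g a)) {0..2*pi}"
    using has_integral_linear[OF has_integral_circle_mean[OF g r] bounded_linear_Re] by (simp add: o_def)
  have nn: "0 \<le> Re (g (a + of_real r * cis t))" for t
    using r by (intro nonneg) (auto simp: dist_norm norm_mult)
  have "(\<integral>\<^sup>+t\<in>{0..2*pi}. ennreal (Re (g (a + of_real r * cis t))) \<partial>lborel)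
     = (\<integral>\<^sup>+t. ennreal (indicator {0..2*pi} t * Re (g (a + of_real r * cis t))) \<partial>lborel)"
    by (intro nn_integral_cong) (auto simp: indicator_def)
  also have "\<dots> = ennreal (Re (of_real (2 * pi) * g a))"
    by (rule nn_integral_has_integral_lebesgue[OF nn int])
  also have "Re (of_real (2 * pi) * g a) = (2 * pi) * Re (g a)" by simp
  also have "ennreal ((2 * pi) * Re (g a)) / ennreal (2 * pi) = ennreal (Re (g a))"
    using nonneg[of a] r by (subst divide_ennreal) auto
  finally show ?thesis .
qed

text \<open>The Poisson kernel (1 - |z|^2) / |1 - z|^2, written as the real part of a holomorphic
  function so that Cauchy's formula yields the mean value property.\<close>

definition poisson_one :: "complex \<Rightarrow> ennreal" where
  "poisson_one z = ennreal (Re ((1 + z) / (1 - z)))"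

lemma Re_poisson: "Re ((1 + z) / (1 - z)) = (1 - (cmod z)\<^sup>2) / (cmod (1 - z))\<^sup>2"
proof -
  have "(1 + z) / (1 - z) = (1 + z) * cnj (1 - z) / (cmod (1 - z))\<^sup>2"
    by (rule complex_div_cnj)
  then have "Re ((1 + z) / (1 - z)) = Re ((1 + z) * cnj (1 - z)) / (cmod (1 - z))\<^sup>2"
    by (metis Re_divide_of_real)
  also have "Re ((1 + z) * cnj (1 - z)) = 1 - (cmod z)\<^sup>2"
    unfolding cmod_power2 by (simp add: power2_eq_square algebra_simps)
  finally show ?thesis .
qed

lemma Re_poisson_pos:
  assumes "z \<in> unit_disk"
  shows "0 < Re ((1 + z) / (1 - z))"
proof -
  have "z \<noteq> 1" "(cmod z)\<^sup>2 < 1" using assms by (auto simp: power_less_one_iff abs_square_less_1)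
  then show ?thesis unfolding Re_poisson by simp
qed

lemma poisson_holomorphic: "(\<lambda>z. (1 + z) / (1 - z)) holomorphic_on unit_disk"
  by (intro holomorphic_intros) auto

lemma poisson_one_mean:
  assumes "0 < r" "cball a r \<subseteq> unit_disk"
  shows "(\<integral>\<^sup>+t\<in>{0..2*pi}. poisson_one (a + of_real r * cis t) \<partial>lborel) / ennreal (2*pi) = poisson_one a"
  unfolding poisson_one_def using assms
  by (intro nn_integral_circle_mean holomorphic_on_subset[OF poisson_holomorphic] less_imp_le[OF Re_poisson_pos]) auto

lemma superharmonic_weight_poisson_one: "superharmonic_weight poisson_one"
  unfolding superharmonic_weight_def
proof (intro conjI ballI allI impI)
  fix z assume z: "z \<in> unit_disk"
  show "0 < poisson_one z" using Re_poisson_pos[OF z] by (simp add: poisson_one_def)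
  have "isCont (\<lambda>z. (1 + z) / (1 - z)) z" using z by (auto intro!: continuous_intros)
  then have "(\<lambda>z. (1 + z) / (1 - z)) \<midarrow>z\<rightarrow> (1 + z) / (1 - z)" by (simp add: isCont_def)
  then have "(poisson_one \<longlongrightarrow> poisson_one z) (at z)"
    unfolding poisson_one_def by (intro tendsto_ennrealI tendsto_Re)
  then show "poisson_one z \<le> Liminf (at z) poisson_one"
    by (simp add: lim_imp_Liminf)
next
  show "\<exists>z\<in>unit_disk. poisson_one z < \<infinity>" by (intro bexI[of _ 0]) (auto simp: poisson_one_def)
next
  fix a :: complex and r :: real
  assume "0 < r" "cball a r \<subseteq> unit_disk"
  then show "(\<integral>\<^sup>+t\<in>{0..2*pi}. poisson_one (a + of_real r * cis t) \<partial>lborel) / ennreal (2*pi) \<le> poisson_one a"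
    using poisson_one_mean by simp
qed

section \<open>Moments of the disk and energies of powers\<close>

text \<open>Layer cake: for k > 0, |z|^(2k) is the integral of k s^(k-1) over s from 0 to |z|^2.
  Fubini leaves the area \<pi> (1 - s) of an annulus and a polynomial in one variable.\<close>

lemma nn_integral_disk_power:
  "(\<integral>\<^sup>+z\<in>unit_disk. ennreal (cmod z ^ (2 * k)) \<partial>lborel) = ennreal (pi / (real k + 1))"
proof (cases k)
  case 0
  then show ?thesis by (simp add: emeasure_ball eval_unit_ball_vol)
next
  case (Suc n)
  define F where "F = (\<lambda>s. ennreal ((real n + 1) * s ^ n))"
  have [measurable]: "unit_disk \<in> sets (borel :: complex measure)" by simp
  have [measurable]: "F \<in> borel_measurable borel" unfolding F_def by measurable
  have inner: "ennreal (cmod z ^ (2 * k)) * indicator unit_disk z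
      = (\<integral>\<^sup>+s. F s * indicator {s. 0 \<le> s \<and> s \<le> 1} s * (indicator {s. s \<le> (cmod z)\<^sup>2} s * indicator unit_disk z) \<partial>lborel)" for z :: complex
  proof (cases "z \<in> unit_disk")
    case True
    then have z1: "(cmod z)\<^sup>2 \<le> 1" by (simp add: power_le_one)
    have "(\<integral>\<^sup>+s. F s * indicator {s. 0 \<le> s \<and> s \<le> 1} s * (indicator {s. s \<le> (cmod z)\<^sup>2} s * indicator unit_disk z) \<partial>lborel)
       = (\<integral>\<^sup>+s\<in>{0..(cmod z)\<^sup>2}. ennreal ((real n + 1) * s ^ n) \<partial>lborel)"
      using True z1 by (intro nn_integral_cong) (auto simp: F_def indicator_def)
    also have "\<dots> = ennreal (((cmod z)\<^sup>2) ^ Suc n - 0 ^ Suc n)"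
    proof (rule nn_integral_FTC_Icc[where F = "\<lambda>s. s ^ Suc n"])
      fix s :: real
      assume "s \<in> {0..(cmod z)\<^sup>2}"
      then show "0 \<le> (real n + 1) * s ^ n" by auto
      show "((\<lambda>s. s ^ Suc n) has_real_derivative (real n + 1) * s ^ n) (at s)"
        using DERIV_power_Suc[OF DERIV_ident, of n s UNIV] by (simp add: add.commute)
    qed auto
    moreover have "cmod z ^ (2 * k) = ((cmod z)\<^sup>2) ^ Suc n" by (simp only: power_mult Suc)
    ultimately show ?thesis using True by simp
  qed simp
  have vol: "emeasure lborel {z::complex. s \<le> (cmod z)\<^sup>2 \<and> cmod z < 1} = ennreal (pi * (1 - s))" if s: "0 \<le> s" "s \<le> 1" for s
  proof -
    have "{z::complex. s \<le> (cmod z)\<^sup>2 \<and> cmod z < 1} = ball 0 1 - ball 0 (sqrt s)"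
      using s by (auto simp: not_less real_le_lsqrt real_le_rsqrt sqrt_le_D dest: real_sqrt_le_mono)
    then have "emeasure lborel {z::complex. s \<le> (cmod z)\<^sup>2 \<and> cmod z < 1} = emeasure lborel (ball (0::complex) 1 - ball 0 (sqrt s))"
      by (simp only:)
    also have "\<dots> = emeasure lborel (ball (0::complex) 1) - emeasure lborel (ball (0::complex) (sqrt s))"
    proof (rule emeasure_Diff)
      show "emeasure lborel (ball (0::complex) (sqrt s)) \<noteq> \<infinity>"
        using emeasure_lborel_ball_finite[of "0::complex" "sqrt s"] by simp
      show "ball (0::complex) (sqrt s) \<subseteq> ball 0 1"
        using s by (intro subset_ball) simp
    qed simp_all
    also have "\<dots> = ennreal pi - ennreal (pi * s)"
      using s by (simp add: emeasure_ball eval_unit_ball_vol)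
    also have "\<dots> = ennreal (pi * (1 - s))"
      using s by (subst ennreal_minus) (auto simp: algebra_simps)
    finally show ?thesis .
  qed
  have "(\<integral>\<^sup>+z\<in>unit_disk. ennreal (cmod z ^ (2 * k)) \<partial>lborel)
     = (\<integral>\<^sup>+z. (\<integral>\<^sup>+s. F s * indicator {s. 0 \<le> s \<and> s \<le> 1} s * (indicator {s. s \<le> (cmod z)\<^sup>2} s * indicator unit_disk z) \<partial>lborel) \<partial>lborel)"
    by (simp only: inner)
  also have "\<dots> = (\<integral>\<^sup>+s. (\<integral>\<^sup>+z. F s * indicator {s. 0 \<le> s \<and> s \<le> 1} s * (indicator {s. s \<le> (cmod z)\<^sup>2} s * indicator unit_disk z) \<partial>lborel) \<partial>lborel)"
    by (rule lborel_pair.Fubini') measurable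
  also have "\<dots> = (\<integral>\<^sup>+s\<in>{0..1}. ennreal (pi * (real n + 1) * (s ^ n - s ^ Suc n)) \<partial>lborel)"
  proof (rule nn_integral_cong)
    fix s :: real
    have "(\<integral>\<^sup>+z. F s * indicator {s. 0 \<le> s \<and> s \<le> 1} s * (indicator {s. s \<le> (cmod z)\<^sup>2} s * indicator unit_disk z) \<partial>lborel)
       = (\<integral>\<^sup>+z. (F s * indicator {s. 0 \<le> s \<and> s \<le> 1} s) * indicator {z. s \<le> (cmod z)\<^sup>2 \<and> cmod z < 1} z \<partial>lborel)"
      by (intro nn_integral_cong) (auto simp: indicator_def)
    also have "\<dots> = F s * indicator {s. 0 \<le> s \<and> s \<le> 1} s * emeasure lborel {z::complex. s \<le> (cmod z)\<^sup>2 \<and> cmod z < 1}"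
      by (rule nn_integral_cmult_indicator) measurable
    also have "\<dots> = ennreal (pi * (real n + 1) * (s ^ n - s ^ Suc n)) * indicator {0..1} s"
    proof (cases "0 \<le> s \<and> s \<le> 1")
      case True
      then have "F s * ennreal (pi * (1 - s)) = ennreal ((real n + 1) * s ^ n * (pi * (1 - s)))"
        unfolding F_def by (subst ennreal_mult) auto
      with True show ?thesis by (simp add: vol algebra_simps)
    qed (auto simp: indicator_def)
    finally show "(\<integral>\<^sup>+z. F s * indicator {s. 0 \<le> s \<and> s \<le> 1} s * (indicator {s. s \<le> (cmod z)\<^sup>2} s * indicator unit_disk z) \<partial>lborel)
       = ennreal (pi * (real n + 1) * (s ^ n - s ^ Suc n)) * indicator {0..1} s" .
  qed
  also have "\<dots> = ennreal ((pi * (1 ^ Suc n - (real n + 1) / (real n + 2) * 1 ^ Suc (Suc n))) - (pi * (0 ^ Suc n - (real n + 1) / (real n + 2) * 0 ^ Suc (Suc n))))"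
  proof (rule nn_integral_FTC_Icc[where F = "\<lambda>s. pi * (s ^ Suc n - (real n + 1) / (real n + 2) * s ^ Suc (Suc n))"])
    fix s :: real assume s: "s \<in> {0..1}"
    have "((\<lambda>s. pi * (s ^ Suc n - (real n + 1) / (real n + 2) * s ^ Suc (Suc n))) has_real_derivative
       pi * ((1 + real n) * (1 * s ^ n) - (real n + 1) / (real n + 2) * ((1 + real (Suc n)) * (1 * s ^ Suc n)))) (at s)"
      by (intro DERIV_cmult DERIV_diff DERIV_power_Suc[OF DERIV_ident])
    then have "((\<lambda>s. pi * (s ^ Suc n - (real n + 1) / (real n + 2) * s ^ Suc (Suc n))) has_real_derivative
       pi * ((real n + 1) * s ^ n - (real n + 1) / (real n + 2) * ((real n + 2) * s ^ Suc n))) (at s)"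
      by (rule DERIV_cong) (simp add: algebra_simps)
    moreover have "pi * ((real n + 1) * s ^ n - (real n + 1) / (real n + 2) * ((real n + 2) * s ^ Suc n)) = pi * (real n + 1) * (s ^ n - s ^ Suc n)"
    proof -
      have "(real n + 1) / (real n + 2) * ((real n + 2) * x) = (real n + 1) * x" for x
        using of_nat_0_le_iff[of n, where 'a = real] by (simp add: field_simps add_nonneg_eq_0_iff)
      then show ?thesis by (simp only: right_diff_distrib mult.assoc)
    qed
    ultimately show "((\<lambda>s. pi * (s ^ Suc n - (real n + 1) / (real n + 2) * s ^ Suc (Suc n))) has_real_derivative
       pi * (real n + 1) * (s ^ n - s ^ Suc n)) (at s)"
      by (simp only:)
    show "0 \<le> pi * (real n + 1) * (s ^ n - s ^ Suc n)"
      using s power_decreasing[of n "Suc n" s] by (intro mult_nonneg_nonneg) auto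
  qed auto
  also have "\<dots> = ennreal (pi / (real k + 1))"
    using Suc by (simp add: field_simps)
  finally show ?thesis .
qed

text \<open>Radial integrands see only the circle means of the kernel about 0, and these all equal
  its value 1 at 0, so the unweighted moments reappear.\<close>

lemma nn_integral_disk_power_poisson_one:
  "(\<integral>\<^sup>+z\<in>unit_disk. ennreal (cmod z ^ (2 * k)) * poisson_one z \<partial>lborel) = ennreal (pi / (real k + 1))"
proof -
  define \<phi> where "\<phi> = (\<lambda>s. ennreal (s ^ (2 * k)) * indicator {..<1} s)"
  define g where "g = (\<lambda>z. poisson_one z * indicator unit_disk z)"
  have [measurable]: "\<phi> \<in> borel_measurable borel" unfolding \<phi>_def by measurable
  have [measurable]: "g \<in> borel_measurable borel"
    unfolding g_def by (rule superharmonic_weight_measurable[OF superharmonic_weight_poisson_one])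
  have "(\<integral>\<^sup>+z\<in>unit_disk. ennreal (cmod z ^ (2 * k)) * poisson_one z \<partial>lborel) = (\<integral>\<^sup>+z. \<phi> (cmod z) * g z \<partial>lborel)"
    by (intro nn_integral_cong) (auto simp: \<phi>_def g_def indicator_def)
  also have "\<dots> = (\<integral>\<^sup>+z. \<phi> (cmod z) * ((\<integral>\<^sup>+t\<in>{0..2*pi}. g (cmod z * cis t) \<partial>lborel) / ennreal (2*pi)) \<partial>lborel)"
    by (rule nn_integral_circle_average) measurable
  also have "\<dots> = (\<integral>\<^sup>+z. \<phi> (cmod z) \<partial>lborel)"
  proof (rule nn_integral_cong_AE, rule AE_mp[OF AE_lborel_singleton[of 0]], rule AE_I2, rule impI)
    fix z :: complex assume z: "z \<noteq> 0"
    show "\<phi> (cmod z) * ((\<integral>\<^sup>+t\<in>{0..2*pi}. g (cmod z * cis t) \<partial>lborel) / ennreal (2*pi)) = \<phi> (cmod z)"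
    proof (cases "cmod z < 1")
      case True
      have "(\<integral>\<^sup>+t\<in>{0..2*pi}. g (cmod z * cis t) \<partial>lborel) = (\<integral>\<^sup>+t\<in>{0..2*pi}. poisson_one (0 + of_real (cmod z) * cis t) \<partial>lborel)"
        using True by (intro nn_integral_cong) (auto simp: g_def norm_mult)
      also have "\<dots> / ennreal (2*pi) = 1"
        using True z by (subst poisson_one_mean) (auto simp: poisson_one_def)
      finally show ?thesis by simp
    qed (simp add: \<phi>_def)
  qed
  also have "\<dots> = (\<integral>\<^sup>+z\<in>unit_disk. ennreal (cmod z ^ (2 * k)) \<partial>lborel)"
    by (intro nn_integral_cong) (auto simp: \<phi>_def indicator_def)
  finally show ?thesis by (simp add: nn_integral_disk_power)
qed

lemma energy_poisson_one_power:
  assumes "m \<ge> 1"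
  shows "energy poisson_one (\<lambda>z. z ^ m) = ennreal (pi * real m)"
proof -
  obtain k where m: "m = Suc k" using assms by (cases m) auto
  have "energy poisson_one (\<lambda>z. z ^ m) = (\<integral>\<^sup>+z. ennreal ((real m)\<^sup>2) * (ennreal (cmod z ^ (2 * k)) * poisson_one z * indicator unit_disk z) \<partial>lborel)"
    unfolding energy_def
  proof (rule nn_integral_cong)
    fix z :: complex
    have "deriv (\<lambda>z. z ^ m) z = of_nat m * z ^ k"
      unfolding m by (rule DERIV_imp_deriv) (use DERIV_power_Suc[OF DERIV_ident, of k z UNIV] in simp)
    then have "(cmod (deriv (\<lambda>z. z ^ m) z))\<^sup>2 = (real m)\<^sup>2 * cmod z ^ (2 * k)"
      by (simp add: norm_mult norm_power power_mult_distrib power_mult[symmetric] mult.commute del: of_nat_Suc)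
    then show "ennreal ((cmod (deriv (\<lambda>z. z ^ m) z))\<^sup>2) * poisson_one z * indicator unit_disk z
      = ennreal ((real m)\<^sup>2) * (ennreal (cmod z ^ (2 * k)) * poisson_one z * indicator unit_disk z)"
      by (simp add: ennreal_mult mult.assoc)
  qed
  also have "\<dots> = ennreal ((real m)\<^sup>2) * ennreal (pi / (real k + 1))"
  proof (subst nn_integral_cmult)
    have "(\<lambda>z. ennreal (cmod z ^ (2 * k)) * (poisson_one z * indicator unit_disk z)) \<in> borel_measurable borel"
      using superharmonic_weight_measurable[OF superharmonic_weight_poisson_one] by measurable
    then show "(\<lambda>z. ennreal (cmod z ^ (2 * k)) * poisson_one z * indicator unit_disk z) \<in> borel_measurable lborel"
      by (simp add: mult.assoc)
  qed (simp add: nn_integral_disk_power_poisson_one)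
  also have "\<dots> = ennreal (pi * real m)"
  proof -
    have "(real m)\<^sup>2 * (pi / (real k + 1)) = pi * real m" by (simp add: m power2_eq_square field_simps)
    then show ?thesis by (subst ennreal_mult[symmetric]) auto
  qed
  finally show ?thesis .
qed

subsection \<open>A lacunary function\<close>

text \<open>The derivative is z^(m-1) (1 - (m + 1)(1 - z)), and the second factor squared is at most
  2 + 2 (m + 1)^2 |1 - z|^2. The large part cancels the denominator of the kernel and leaves the
  moment difference \<pi> / m - \<pi> / (m + 1), which offsets (m + 1)^2. The total 2 \<pi> (m + 2)
  / m is largest at m = 1.\<close>

lemma energy_poisson_one_difference:
  assumes "m \<ge> 1"
  shows "energy poisson_one (\<lambda>z. z ^ Suc m - z ^ m) \<le> ennreal (6 * pi)"
proof -
  obtain k where m: "m = Suc k" using assms by (cases m) auto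
  define W where "W = (\<lambda>z. poisson_one z * indicator unit_disk z)"
  have [measurable]: "W \<in> borel_measurable borel"
    unfolding W_def by (rule superharmonic_weight_measurable[OF superharmonic_weight_poisson_one])
  have [measurable]: "unit_disk \<in> sets (borel :: complex measure)" by simp
  define b where "b = 2 * (real m + 1)\<^sup>2"
  define X where "X = (\<integral>\<^sup>+z\<in>unit_disk. ennreal (cmod z ^ (2 * k) - cmod z ^ (2 * m)) \<partial>lborel)"
  have X: "X = ennreal (pi / real m - pi / (real m + 1))"
  proof -
    have "X + ennreal (pi / (real m + 1)) = X + (\<integral>\<^sup>+z\<in>unit_disk. ennreal (cmod z ^ (2 * m)) \<partial>lborel)"
      by (simp add: nn_integral_disk_power)
    also have "\<dots> = (\<integral>\<^sup>+z. ennreal (cmod z ^ (2 * k) - cmod z ^ (2 * m)) * indicator unit_disk z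
         + ennreal (cmod z ^ (2 * m)) * indicator unit_disk z \<partial>lborel)"
      unfolding X_def by (rule nn_integral_add[symmetric]) measurable
    also have "\<dots> = (\<integral>\<^sup>+z\<in>unit_disk. ennreal (cmod z ^ (2 * k)) \<partial>lborel)"
    proof (rule nn_integral_cong)
      fix z :: complex
      have "cmod z ^ (2 * m) \<le> cmod z ^ (2 * k)" if "z \<in> unit_disk"
        using that by (intro power_decreasing) (auto simp: m)
      then show "ennreal (cmod z ^ (2 * k) - cmod z ^ (2 * m)) * indicator unit_disk z
         + ennreal (cmod z ^ (2 * m)) * indicator unit_disk z = ennreal (cmod z ^ (2 * k)) * indicator unit_disk z"
        by (simp add: indicator_def ennreal_plus[symmetric] del: ennreal_plus)
    qed
    also have "\<dots> = ennreal (pi / real m)"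
      unfolding nn_integral_disk_power by (simp add: m add.commute)
    finally have eq: "X + ennreal (pi / (real m + 1)) = ennreal (pi / real m)" .
    have "X = X + ennreal (pi / (real m + 1)) - ennreal (pi / (real m + 1))" by simp
    then show ?thesis unfolding eq by (simp add: ennreal_minus)
  qed
  have "energy poisson_one (\<lambda>z. z ^ Suc m - z ^ m)
     \<le> (\<integral>\<^sup>+z. ennreal b * (ennreal (cmod z ^ (2 * k) - cmod z ^ (2 * m)) * indicator unit_disk z)
           + 2 * (ennreal (cmod z ^ (2 * k)) * W z) \<partial>lborel)"
    unfolding energy_def
  proof (rule nn_integral_mono)
    fix z :: complex
    show "ennreal ((cmod (deriv (\<lambda>z. z ^ Suc m - z ^ m) z))\<^sup>2) * poisson_one z * indicator unit_disk z
      \<le> ennreal b * (ennreal (cmod z ^ (2 * k) - cmod z ^ (2 * m)) * indicator unit_disk z) + 2 * (ennreal (cmod z ^ (2 * k)) * W z)"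
    proof (cases "z \<in> unit_disk")
      case True
      define P where "P = (1 - (cmod z)\<^sup>2) / (cmod (1 - z))\<^sup>2"
      have z1: "cmod (1 - z) \<noteq> 0" using True by auto
      have z2: "(cmod z)\<^sup>2 \<le> 1" using True by (simp add: power_le_one)
      have P0: "P \<ge> 0" using z2 by (simp add: P_def)
      have P: "poisson_one z = ennreal P" unfolding poisson_one_def Re_poisson P_def ..
      have "((\<lambda>z. z ^ Suc m - z ^ m) has_field_derivative (1 + of_nat m) * (1 * z ^ m) - (1 + of_nat k) * (1 * z ^ k)) (at z)"
        unfolding m by (intro DERIV_diff DERIV_power_Suc[OF DERIV_ident])
      then have "deriv (\<lambda>z. z ^ Suc m - z ^ m) z = (1 + of_nat m) * (1 * z ^ m) - (1 + of_nat k) * (1 * z ^ k)"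
        by (rule DERIV_imp_deriv)
      also have "\<dots> = z ^ k * (1 - of_nat (m + 1) * (1 - z))"
        by (simp add: m algebra_simps)
      finally have d: "(cmod (deriv (\<lambda>z. z ^ Suc m - z ^ m) z))\<^sup>2 = cmod z ^ (2 * k) * (cmod (1 - of_nat (m + 1) * (1 - z)))\<^sup>2"
        by (simp add: norm_mult norm_power power_mult_distrib power_mult[symmetric] mult.commute del: of_nat_Suc)
      have "cmod (1 - of_nat (m + 1) * (1 - z)) \<le> 1 + (real m + 1) * cmod (1 - z)"
        by (rule order_trans[OF norm_triangle_ineq4]) (simp add: norm_mult del: of_nat_add of_nat_Suc, simp add: add.commute)
      then have "(cmod (1 - of_nat (m + 1) * (1 - z)))\<^sup>2 \<le> (1 + (real m + 1) * cmod (1 - z))\<^sup>2"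
        by (rule power_mono) simp
      also have "\<dots> \<le> b * (cmod (1 - z))\<^sup>2 + 2"
      proof -
        have "(1 + x)\<^sup>2 \<le> 2 * x\<^sup>2 + 2" for x :: real
          using zero_le_power2[of "x - 1"] by (simp add: power2_eq_square algebra_simps)
        from this[of "(real m + 1) * cmod (1 - z)"] show ?thesis
          by (simp only: b_def power_mult_distrib mult.assoc)
      qed
      finally have "(cmod (1 - of_nat (m + 1) * (1 - z)))\<^sup>2 \<le> b * (cmod (1 - z))\<^sup>2 + 2" .
      then have "cmod z ^ (2 * k) * (cmod (1 - of_nat (m + 1) * (1 - z)))\<^sup>2 * P \<le> cmod z ^ (2 * k) * (b * (cmod (1 - z))\<^sup>2 + 2) * P"
        by (intro mult_right_mono mult_left_mono P0) auto
      also have "\<dots> = b * (cmod z ^ (2 * k) * ((cmod (1 - z))\<^sup>2 * P)) + 2 * (cmod z ^ (2 * k) * P)"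
        by (simp add: algebra_simps)
      also have "(cmod (1 - z))\<^sup>2 * P = 1 - (cmod z)\<^sup>2" using z1 by (simp add: P_def)
      also have "cmod z ^ (2 * k) * (1 - (cmod z)\<^sup>2) = cmod z ^ (2 * k) - cmod z ^ (2 * m)"
        by (simp add: m algebra_simps power2_eq_square)
      finally have le: "(cmod (deriv (\<lambda>z. z ^ Suc m - z ^ m) z))\<^sup>2 * P \<le> b * (cmod z ^ (2 * k) - cmod z ^ (2 * m)) + 2 * (cmod z ^ (2 * k) * P)"
        unfolding d .
      have pw: "0 \<le> cmod z ^ (2 * k) - cmod z ^ (2 * m)"
        using True power_decreasing[of "2 * k" "2 * m" "cmod z"] by (simp add: m)
      have "ennreal ((cmod (deriv (\<lambda>z. z ^ Suc m - z ^ m) z))\<^sup>2) * ennreal P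
          \<le> ennreal (b * (cmod z ^ (2 * k) - cmod z ^ (2 * m)) + 2 * (cmod z ^ (2 * k) * P))"
        using P0 le by (simp add: ennreal_mult[symmetric] ennreal_leI del: ennreal_plus)
      also have "\<dots> = ennreal b * ennreal (cmod z ^ (2 * k) - cmod z ^ (2 * m)) + 2 * (ennreal (cmod z ^ (2 * k)) * ennreal P)"
        using P0 pw by (simp add: ennreal_mult b_def)
      finally show ?thesis using True P by (simp add: W_def)
    qed simp
  qed
  also have "\<dots> = ennreal b * X + 2 * (\<integral>\<^sup>+z. ennreal (cmod z ^ (2 * k)) * W z \<partial>lborel)"
    unfolding X_def by (simp add: nn_integral_add nn_integral_cmult)
  also have "(\<integral>\<^sup>+z. ennreal (cmod z ^ (2 * k)) * W z \<partial>lborel) = ennreal (pi / real m)"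
    using nn_integral_disk_power_poisson_one[of k] by (simp add: W_def mult.assoc m add.commute)
  also have "ennreal b * X + 2 * ennreal (pi / real m) = ennreal (b * (pi / real m - pi / (real m + 1)) + 2 * (pi / real m))"
  proof -
    have "0 \<le> pi / real m - pi / (real m + 1)" using assms by (simp add: frac_le)
    moreover have "ennreal b * ennreal u + 2 * ennreal v = ennreal (b * u + 2 * v)" if "0 \<le> b" "0 \<le> u" "0 \<le> v" for b u v
      using that by (simp add: ennreal_mult)
    ultimately show ?thesis unfolding X by (simp only: b_def) simp
  qed
  also have "\<dots> \<le> ennreal (6 * pi)"
  proof (rule ennreal_leI)
    have m0: "real m \<ge> 1" using assms by simp
    have eq: "pi / real m - pi / (real m + 1) = pi / (real m * (real m + 1))" using m0 by (simp add: field_simps)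
    have "b * (pi / real m - pi / (real m + 1)) + 2 * (pi / real m) = (2 * pi * (real m + 1) + 2 * pi) / real m"
    proof -
      have "2 * c\<^sup>2 * (p / (M * c)) + 2 * (p / M) = (2 * p * c + 2 * p) / M" if "M \<noteq> 0" "c \<noteq> 0" for c p M :: real
        using that by (simp add: power2_eq_square field_simps)
      from this[of "real m" "real m + 1" pi] m0 show ?thesis
        unfolding b_def eq by linarith
    qed
    also have "\<dots> \<le> 6 * pi"
    proof -
      have "pi * 1 \<le> pi * real m" using m0 by (intro mult_left_mono) auto
      then show ?thesis using m0 by (simp add: field_simps)
    qed
    finally show "b * (pi / real m - pi / (real m + 1)) + 2 * (pi / real m) \<le> 6 * pi" .
  qed
  finally show ?thesis .
qed

text \<open>Each sum is half of \<open>p j\<close> plus a sum of the same kind starting at j + 1,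
  and the parallelogram law gives (2 C + 2 C) / 4 = C. The offset \<open>j\<close> is there for the
  induction.\<close>

lemma energy_dyadic_sum_le:
  assumes w: "superharmonic_weight \<omega>" and p: "\<And>j. p j holomorphic_on unit_disk" "\<And>j. energy \<omega> (p j) \<le> C"
  shows "energy \<omega> (\<lambda>z. \<Sum>i<K. (1/2) ^ Suc i * p (j + i) z) \<le> C"
proof (induction K arbitrary: j)
  case 0
  show ?case by (simp add: energy_def)
next
  case (Suc K)
  define T where "T = (\<lambda>z. \<Sum>i<K. (1/2) ^ Suc i * p (Suc j + i) z)"
  have T: "T holomorphic_on unit_disk" unfolding T_def by (intro holomorphic_intros p)
  have "(\<lambda>z. \<Sum>i<Suc K. (1/2) ^ Suc i * p (j + i) z) = (\<lambda>z. (1/2) * (p j z + T z))"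
    unfolding sum.lessThan_Suc_shift T_def by (auto simp: distrib_left sum_distrib_left algebra_simps)
  then have "energy \<omega> (\<lambda>z. \<Sum>i<Suc K. (1/2) ^ Suc i * p (j + i) z) = ennreal ((cmod (1/2))\<^sup>2) * energy \<omega> (\<lambda>z. p j z + T z)"
    using energy_cmult[OF w, of "\<lambda>z. p j z + T z" "1/2"] p T by (simp add: holomorphic_on_add)
  also have "\<dots> \<le> ennreal ((cmod (1/2))\<^sup>2) * (2 * energy \<omega> (p j) + 2 * energy \<omega> T)"
    unfolding energy_parallelogram[OF w p(1) T, symmetric] by (intro mult_left_mono) auto
  also have "\<dots> \<le> ennreal ((cmod (1/2))\<^sup>2) * (2 * C + 2 * C)"
    using p(2) Suc.IH[of "Suc j"] unfolding T_def by (intro mult_left_mono add_mono) auto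
  also have "\<dots> = C"
  proof -
    have "ennreal ((cmod (1/2))\<^sup>2) * (2 * C + 2 * C) = (ennreal (1/4) * 4) * C"
      by (simp add: power2_eq_square norm_divide distrib_right[symmetric] mult.assoc)
    also have "ennreal (1/4) * 4 = ennreal (1/4 * 4)" by (subst ennreal_mult) auto
    finally show ?thesis by simp
  qed
  finally show ?case .
qed

text \<open>Terms with i \<ge> k vanish since 4^(i+1) > k, so a finite sum suffices. Starting at
  exponent 4 makes every 4^(i+1) even, hence distinct from every 4^(j+1) + 1.\<close>

definition lacunary_coeff :: "nat \<Rightarrow> complex" where
  "lacunary_coeff k = (\<Sum>i<k. (1/2) ^ Suc i * (of_bool (k = 4 ^ Suc i + 1) - of_bool (k = 4 ^ Suc i)))"

definition lacunary :: "complex \<Rightarrow> complex" where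
  "lacunary z = (\<Sum>k. lacunary_coeff k * z ^ k)"

lemma less_four_power: "i < 4 ^ i" for i :: nat
  by (rule less_le_trans[OF less_exp power_mono]) auto

lemma lacunary_coeff_extend:
  assumes "k \<le> n"
  shows "lacunary_coeff k = (\<Sum>i<n. (1/2) ^ Suc i * (of_bool (k = 4 ^ Suc i + 1) - of_bool (k = 4 ^ Suc i)))"
  unfolding lacunary_coeff_def
proof (rule sum.mono_neutral_left)
  show "\<forall>i\<in>{..<n} - {..<k}. (1/2) ^ Suc i * (of_bool (k = 4 ^ Suc i + 1) - of_bool (k = 4 ^ Suc i)) = (0::complex)"
  proof
    fix i assume "i \<in> {..<n} - {..<k}"
    then have "k < 4 ^ Suc i" using less_four_power[of "Suc i"] by simp
    then show "(1/2) ^ Suc i * (of_bool (k = 4 ^ Suc i + 1) - of_bool (k = 4 ^ Suc i)) = (0::complex)" by simp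
  qed
qed (use assms in auto)

lemma norm_lacunary_coeff_le: "cmod (lacunary_coeff k) \<le> 1"
proof -
  have "cmod (lacunary_coeff k) \<le> (\<Sum>i<k. (1/2) ^ Suc i)"
    unfolding lacunary_coeff_def
    by (rule sum_norm_le) (auto simp: norm_mult norm_power norm_divide of_bool_def)
  also have "\<dots> = 1 - (1/2) ^ k" by (induction k) (auto simp: field_simps)
  also have "\<dots> \<le> 1" by simp
  finally show ?thesis .
qed

lemma lacunary_sums:
  assumes "z \<in> unit_disk"
  shows "(\<lambda>k. lacunary_coeff k * z ^ k) sums lacunary z"
proof -
  have "summable (\<lambda>k. lacunary_coeff k * z ^ k)"
  proof (rule summable_comparison_test)
    show "\<exists>N. \<forall>n\<ge>N. cmod (lacunary_coeff n * z ^ n) \<le> cmod z ^ n"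
      using norm_lacunary_coeff_le by (auto simp: norm_mult norm_power intro!: mult_left_le_one_le)
    show "summable (\<lambda>k. cmod z ^ k)" using assms by (intro summable_geometric) auto
  qed
  then show ?thesis by (simp add: lacunary_def summable_sums)
qed

lemma lacunary_holomorphic: "lacunary holomorphic_on unit_disk"
  by (rule power_series_holomorphic[where a = lacunary_coeff]) (use lacunary_sums in simp)

lemma taylor_coeff_lacunary: "taylor_coeff lacunary k = lacunary_coeff k"
proof -
  have "\<forall>\<^sub>F u in nhds 0. (\<lambda>n. fps_nth (Abs_fps lacunary_coeff) n * u ^ n) sums lacunary u"
    using lacunary_sums by (intro eventually_nhds_in_open[of unit_disk 0, THEN eventually_mono]) auto
  then have "lacunary has_fps_expansion Abs_fps lacunary_coeff"
    by (rule has_fps_expansionI)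
  from fps_nth_fps_expansion[OF this, of k] show ?thesis
    by (simp add: taylor_coeff_def)
qed

lemma lacunary_coeff_power: "lacunary_coeff (4 ^ Suc j) = - ((1/2) ^ Suc j)"
proof -
  have "lacunary_coeff (4 ^ Suc j) = (\<Sum>i<4 ^ Suc j. if i = j then - ((1/2) ^ Suc j) else 0)"
    unfolding lacunary_coeff_def
  proof (rule sum.cong)
    fix i
    have "(4::nat) ^ Suc j \<noteq> 4 ^ Suc i + 1"
    proof
      assume *: "(4::nat) ^ Suc j = 4 ^ Suc i + 1"
      have "even ((4::nat) ^ Suc j)" "even ((4::nat) ^ Suc i)" by auto
      then show False unfolding * by simp
    qed
    moreover have "(4::nat) ^ Suc j = 4 ^ Suc i \<longleftrightarrow> i = j" by (auto simp: power_inject_exp simp del: power_Suc)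
    ultimately show "(1/2) ^ Suc i * (of_bool ((4::nat) ^ Suc j = 4 ^ Suc i + 1) - of_bool ((4::nat) ^ Suc j = 4 ^ Suc i))
       = (if i = j then - ((1/2) ^ Suc j) else (0::complex))" by (simp del: power_Suc)
  qed simp
  also have "\<dots> = - ((1/2) ^ Suc j)"
    using less_four_power[of "Suc j"] by (subst sum.delta) (auto simp del: power_Suc)
  finally show ?thesis .
qed

text \<open>The cut at 4^K + 1 splits no pair: for K > 0 it falls right behind the pair of index K -
  1.\<close>

lemma partial_sum_lacunary:
  "partial_sum (4 ^ K + 1) lacunary z = (\<Sum>i<K. (1/2) ^ Suc i * (z ^ Suc (4 ^ Suc i) - z ^ (4 ^ Suc i)))"
proof -
  define n :: nat where "n = 4 ^ K + 1"
  have Kn: "K \<le> n" using less_four_power[of K] by (simp add: n_def)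
  have "partial_sum n lacunary z
     = (\<Sum>k\<le>n. \<Sum>i<n. (1/2) ^ Suc i * (of_bool (k = 4 ^ Suc i + 1) - of_bool (k = 4 ^ Suc i)) * z ^ k)"
    unfolding partial_sum_def taylor_coeff_lacunary
    by (intro sum.cong refl) (simp only: lacunary_coeff_extend[of _ n] atMost_iff sum_distrib_right)
  also have "\<dots> = (\<Sum>i<n. \<Sum>k\<le>n. (1/2) ^ Suc i * (of_bool (k = 4 ^ Suc i + 1) - of_bool (k = 4 ^ Suc i)) * z ^ k)"
    by (rule sum.swap)
  also have "\<dots> = (\<Sum>i<n. if i < K then (1/2) ^ Suc i * (z ^ Suc (4 ^ Suc i) - z ^ (4 ^ Suc i)) else 0)"
  proof (rule sum.cong)
    fix i
    have iff: "4 ^ Suc i + 1 \<le> n \<longleftrightarrow> i < K" "4 ^ Suc i \<le> n \<longleftrightarrow> i < K"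
    proof -
      have 1: "4 ^ Suc i + 1 \<le> n" if "i < K"
        using power_increasing[of "Suc i" K "4::nat"] that by (simp add: n_def)
      have 2: "n < 4 ^ Suc i" if "\<not> i < K"
      proof -
        have "(4::nat) ^ K \<le> 4 ^ i" using that by (intro power_increasing) auto
        moreover have "(4::nat) ^ i \<ge> 1" by simp
        ultimately show ?thesis unfolding n_def power_Suc by linarith
      qed
      show "4 ^ Suc i + 1 \<le> n \<longleftrightarrow> i < K" "4 ^ Suc i \<le> n \<longleftrightarrow> i < K" using 1 2 by linarith+
    qed
    have "(\<Sum>k\<le>n. (1/2) ^ Suc i * (of_bool (k = 4 ^ Suc i + 1) - of_bool (k = 4 ^ Suc i)) * z ^ k)
      = (1/2) ^ Suc i * ((\<Sum>k\<le>n. if k = 4 ^ Suc i + 1 then z ^ k else 0) - (\<Sum>k\<le>n. if k = 4 ^ Suc i then z ^ k else 0))"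
      unfolding sum_subtractf[symmetric] sum_distrib_left by (intro sum.cong) (auto simp: of_bool_def)
    also have "\<dots> = (if i < K then (1/2) ^ Suc i * (z ^ Suc (4 ^ Suc i) - z ^ (4 ^ Suc i)) else 0)"
      using iff by (simp add: sum.delta del: power_Suc)
    finally show "(\<Sum>k\<le>n. (1/2) ^ Suc i * (of_bool (k = 4 ^ Suc i + 1) - of_bool (k = 4 ^ Suc i)) * z ^ k) = \<dots>" .
  qed simp
  also have "\<dots> = (\<Sum>i<K. (1/2) ^ Suc i * (z ^ Suc (4 ^ Suc i) - z ^ (4 ^ Suc i)))"
    using Kn by (intro sum.mono_neutral_cong_right) auto
  finally show ?thesis by (simp add: n_def)
qed

text \<open>Fatou needs bounded energies only along a subsequence, here the cuts that keep all pairs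
  whole.\<close>

lemma energy_lacunary: "energy poisson_one lacunary \<le> ennreal (6 * pi)"
proof -
  define p :: "nat \<Rightarrow> complex \<Rightarrow> complex" where "p = (\<lambda>j z. z ^ Suc (4 ^ Suc j) - z ^ (4 ^ Suc j))"
  have p: "p j holomorphic_on unit_disk" "energy poisson_one (p j) \<le> ennreal (6 * pi)" for j
    unfolding p_def by (intro holomorphic_intros, intro energy_poisson_one_difference) simp
  have "strict_mono (\<lambda>K. 4 ^ K + 1 :: nat)" by (intro strict_monoI) simp
  then have sub: "filterlim (\<lambda>K. 4 ^ K + 1 :: nat) sequentially sequentially" by (rule filterlim_subseq)
  have "energy poisson_one lacunary \<le> liminf (\<lambda>K. energy poisson_one (partial_sum (4 ^ K + 1) lacunary))"
  proof (rule energy_liminf[OF superharmonic_weight_poisson_one partial_sum_holomorphic])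
    fix z :: complex assume "z \<in> unit_disk"
    from LIMSEQ_deriv_partial_sum[OF lacunary_holomorphic this]
    show "(\<lambda>K. deriv (partial_sum (4 ^ K + 1) lacunary) z) \<longlonglongrightarrow> deriv lacunary z"
      using sub by (rule filterlim_compose)
  qed
  also have "\<dots> \<le> liminf (\<lambda>K. ennreal (6 * pi))"
  proof (intro Liminf_mono always_eventually allI)
    fix K
    have "partial_sum (4 ^ K + 1) lacunary = (\<lambda>z. \<Sum>i<K. (1/2) ^ Suc i * p (0 + i) z)"
      by (rule ext) (simp only: partial_sum_lacunary p_def add_0)
    then show "energy poisson_one (partial_sum (4 ^ K + 1) lacunary) \<le> ennreal (6 * pi)"
      using energy_dyadic_sum_le[where p = p and K = K and j = 0, OF superharmonic_weight_poisson_one p] by (simp only:)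
  qed
  also have "\<dots> = ennreal (6 * pi)" by (simp add: Liminf_const)
  finally show ?thesis .
qed

lemma D_norm_sq_partial_sum_lacunary_not_tendsto_0:
  "\<not> (\<lambda>n. D_norm_sq poisson_one (\<lambda>z. partial_sum n lacunary z - lacunary z)) \<longlonglongrightarrow> 0"
proof
  define x where "x = (\<lambda>n. D_norm_sq poisson_one (\<lambda>z. partial_sum n lacunary z - lacunary z))"
  assume "x \<longlonglongrightarrow> 0"
  \<comment> \<open>If two consecutive distances are below 1/8, the parallelogram law bounds the
    energy of the term between them by 4 \<pi> / 8 = \<pi> / 2.\<close>
  then have "\<forall>\<^sub>F n in sequentially. x n < ennreal (1/8)" by (rule order_tendstoD) auto
  then obtain N where N: "\<And>n. n \<ge> N \<Longrightarrow> x n < ennreal (1/8)" by (auto simp: eventually_sequentially)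
  have E: "energy poisson_one (\<lambda>z. partial_sum n lacunary z - lacunary z) \<le> ennreal (pi / 8)" if "n \<ge> N" for n
  proof -
    define y where "y = energy poisson_one (\<lambda>z. partial_sum n lacunary z - lacunary z)"
    have "y / ennreal pi \<le> x n" unfolding x_def D_norm_sq_def dirichlet_integral_energy y_def by simp
    also have "\<dots> \<le> ennreal (1/8)" using N[OF that] by simp
    finally have "y / ennreal pi * ennreal pi \<le> ennreal (1/8) * ennreal pi" by (rule mult_right_mono) simp
    also have "ennreal (1/8) * ennreal pi = ennreal (pi / 8)" by (subst ennreal_mult[symmetric]) auto
    also have "y / ennreal pi * ennreal pi = y" by (simp add: ennreal_divide_times ennreal_divide_self)
    finally show ?thesis unfolding y_def .
  qed
  \<comment> \<open>The next Taylor term then has degree 4^(N+1) and coefficient of modulus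
    2^-(N+1), hence energy exactly \<pi>.\<close>
  define n where "n = 4 ^ Suc N - (1::nat)"
  have Sn: "Suc n = 4 ^ Suc N" by (simp add: n_def)
  have nN: "N \<le> n" using less_four_power[of "Suc N"] by (simp add: n_def del: power_Suc)
  define d where "d = (\<lambda>n z. partial_sum n lacunary z - lacunary z)"
  have hol: "d n holomorphic_on unit_disk" for n
    unfolding d_def by (intro holomorphic_intros partial_sum_holomorphic lacunary_holomorphic)
  have "ennreal pi = energy poisson_one (\<lambda>z. lacunary_coeff (Suc n) * z ^ Suc n)"
  proof -
    have "(cmod (lacunary_coeff (Suc n)))\<^sup>2 * (pi * real (Suc n)) = pi"
    proof -
      have "real (Suc n) = 4 ^ Suc N" unfolding Sn by simp
      moreover have "(cmod (lacunary_coeff (Suc n)))\<^sup>2 = (1/4) ^ Suc N"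
        unfolding Sn lacunary_coeff_power
        by (simp add: norm_power norm_mult norm_divide power_mult_distrib power2_eq_square power_divide flip: power_mult_distrib)
      ultimately show ?thesis by (simp add: power_divide)
    qed
    moreover have "energy poisson_one (\<lambda>z. lacunary_coeff (Suc n) * z ^ Suc n)
       = ennreal ((cmod (lacunary_coeff (Suc n)))\<^sup>2) * energy poisson_one (\<lambda>z. z ^ Suc n)"
      by (intro energy_cmult superharmonic_weight_poisson_one holomorphic_intros)
    moreover have "energy poisson_one (\<lambda>z. z ^ Suc n) = ennreal (pi * real (Suc n))"
      by (rule energy_poisson_one_power) simp
    ultimately show ?thesis by (simp add: ennreal_mult[symmetric] del: of_nat_Suc)
  qed
  also have "(\<lambda>z. lacunary_coeff (Suc n) * z ^ Suc n) = (\<lambda>z. d (Suc n) z - d n z)"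
    by (auto simp: d_def partial_sum_def taylor_coeff_lacunary)
  also have "energy poisson_one \<dots> \<le> 2 * energy poisson_one (d (Suc n)) + 2 * energy poisson_one (d n)"
    by (rule energy_diff_le[OF superharmonic_weight_poisson_one hol hol])
  also have "\<dots> \<le> 2 * ennreal (pi / 8) + 2 * ennreal (pi / 8)"
    unfolding d_def using nN by (intro add_mono mult_left_mono E) auto
  also have "\<dots> = ennreal (pi / 2)"
  proof -
    have "2 * ennreal v + 2 * ennreal v = ennreal (4 * v)" if "v \<ge> 0" for v
      using that by (simp add: ennreal_mult distrib_right[symmetric])
    from this[of "pi / 8"] show ?thesis by simp
  qed
  finally have "pi \<le> pi / 2" by (subst (asm) ennreal_le_iff) auto
  then show False using pi_gt_zero by linarith
qed

theorem theorem6: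
  shows "(\<forall>\<omega> f. superharmonic_weight \<omega> \<longrightarrow> in_D \<omega> f \<longrightarrow>
            (\<lambda>n. D_norm_sq \<omega> (\<lambda>z. cesaro_mean n f z - f z)) \<longlonglongrightarrow> 0)
       \<and> (\<exists>\<omega> f. superharmonic_weight \<omega> \<and> in_D \<omega> f \<and>
            \<not> ((\<lambda>n. D_norm_sq \<omega> (\<lambda>z. partial_sum n f z - f z)) \<longlonglongrightarrow> 0))"
proof (intro conjI allI impI exI)
  fix \<omega> f assume "superharmonic_weight \<omega>" "in_D \<omega> f"
  then show "(\<lambda>n. D_norm_sq \<omega> (\<lambda>z. cesaro_mean n f z - f z)) \<longlonglongrightarrow> 0"
    by (rule D_norm_sq_cesaro_mean_tendsto_0)
next
  show "superharmonic_weight poisson_one" by (rule superharmonic_weight_poisson_one)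
  have "energy poisson_one lacunary < \<infinity>" using energy_lacunary by (rule le_less_trans) simp
  then show "in_D poisson_one lacunary"
    unfolding in_D_def dirichlet_integral_energy
    using lacunary_holomorphic by (auto simp: divide_ennreal_def inverse_ennreal ennreal_mult_less_top)
  show "\<not> (\<lambda>n. D_norm_sq poisson_one (\<lambda>z. partial_sum n lacunary z - lacunary z)) \<longlonglongrightarrow> 0"
    by (rule D_norm_sq_partial_sum_lacunary_not_tendsto_0)
qed

end
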